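(* Let $N\ge3$ and $d>0$. For every $a\in\mathcal P_N$, $\sigma\in\mathbb R$, $p\in\mathbb R$ and $V\in\mathbb R^N$, $$\mathcal T_\sigma(a^\#)\ge\mathcal T_\sigma(a),\qquad \Lambda_p(V^\#)\ge\Lambda_p(V),$$ where ${}^\#$ denotes the bell-shaped rearrangement, $\mathcal T_\sigma$ is the functional defined in the context, and $\Lambda_p(V)$ is the principal eigenvalue of $$(\mathcal L_{p,V}u)_j=d\,(e^{-p}u_{j+1}+e^{p}u_{j-1}-2u_j)+V_ju_j,\qquad j\in\mathbb Z/N\mathbb Z.$$
   Context: Vectors in $\mathbb R^N$ are indexed by $\mathbb Z/N\mathbb Z$ (indices modulo $N$). $\mathcal P_N=\{a\in(0,\infty)^N:\sum_ja_j^2=1\}$. For $\sigma\in\mathbb R$ and $a\in\mathcal P_N$, $$\mathcal T_\sigma(a):=\min_{\substack{\theta\in\mathbb R^N\\ \sum_j\theta_j=\sigma}}\ \sum_{j=0}^{N-1}a_ja_{j+1}\cosh\theta_j .$$ The matrix of $\mathcal L_{p,V}$ is irreducible and Metzler (nonnegative off-diagonal entries); its principal eigenvalue is its spectral bound (largest real part of an eigenvalue), a real, algebraically simple eigenvalue with a positive eigenvector. Bell-shaped rearrangement: let $\rho_N$ be the ordering of $\{1,\dots,N\}$ given by $$\rho_N=\begin{cases}(1,2,4,\ldots,2M,\,2M-1,2M-3,\ldots,3),&N=2M,\\(1,2,4,\ldots,2M,\,2M+1,2M-1,\ldots,3),&N=2M+1\end{cases}$$ (first $1$, then the even numbers up to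 $N$ increasingly, then the odd numbers greater than $1$ decreasingly). For a vector $x\in\mathbb R^N$ with entries listed with multiplicity in decreasing order as $x_{[1]}\ge x_{[2]}\ge\cdots\ge x_{[N]}$, the vector $x^\#$ places $x_{[\rho_N(1)]},x_{[\rho_N(2)]},\ldots,x_{[\rho_N(N)]}$ consecutively around the cycle $\mathbb Z/N\mathbb Z$ (the same starting site and orientation may be fixed for all vectors; rotations and reflections are regarded as equivalent). *)

theory Defs
  imports "Jordan_Normal_Form.Spectral_Radius"
begin

text \<open>
  Vectors in \<open>\<real>\<^sup>N\<close> are \<^typ>\<open>real vec\<close>s of dimension \<open>N\<close>. The index set \<open>\<int>/N\<int>\<close> is represented by
  \<open>{0..<N}\<close>, with the cyclic neighbours \<open>j + 1\<close> and \<open>j - 1\<close> written out modulo \<open>N\<close>.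
\<close>

abbreviation cyc_succ :: "nat \<Rightarrow> nat \<Rightarrow> nat" where
  "cyc_succ N j \<equiv> (j + 1) mod N"

abbreviation cyc_pred :: "nat \<Rightarrow> nat \<Rightarrow> nat" where
  "cyc_pred N j \<equiv> (j + N - 1) mod N"

definition pos_unit_vecs :: "nat \<Rightarrow> real vec set" where
  "pos_unit_vecs N = {a \<in> carrier_vec N. (\<forall>j<N. 0 < a $ j) \<and> (\<Sum>j<N. (a $ j)\<^sup>2) = 1}"

definition phase_energy :: "real vec \<Rightarrow> real vec \<Rightarrow> real" where
  "phase_energy a \<theta> =
     (let N = dim_vec a in \<Sum>j<N. a $ j * a $ (cyc_succ N j) * cosh (\<theta> $ j))"

definition phase_constraint :: "nat \<Rightarrow> real \<Rightarrow> real vec set" where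
  "phase_constraint N \<sigma> = {\<theta> \<in> carrier_vec N. (\<Sum>j<N. \<theta> $ j) = \<sigma>}"

text \<open>
  \<open>LEAST\<close> is a genuine minimum here; the lemma \<open>phase_energy_min_attained\<close> below shows that it exists
  for every \<open>a \<in> pos_unit_vecs N\<close>.
\<close>

definition T_fun :: "real \<Rightarrow> real vec \<Rightarrow> real" where
  "T_fun \<sigma> a = (LEAST t. t \<in> phase_energy a ` phase_constraint (dim_vec a) \<sigma>)"

definition L_mat :: "real \<Rightarrow> real \<Rightarrow> real vec \<Rightarrow> real mat" where
  "L_mat d p V = (let N = dim_vec V in mat N N (\<lambda>(j, k).
     (if k = cyc_succ N j then d * exp (- p) else 0)
   + (if k = cyc_pred N j then d * exp p else 0)
   + (if k = j then V $ j - 2 * d else 0)))"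

text \<open>The spectral bound: the largest real part of a complex eigenvalue.\<close>

definition spectral_bound :: "real mat \<Rightarrow> real" where
  "spectral_bound A = Max (Re ` spectrum (map_mat complex_of_real A))"

definition principal_eigenvalue :: "real \<Rightarrow> real \<Rightarrow> real vec \<Rightarrow> real" where
  "principal_eigenvalue d p V = spectral_bound (L_mat d p V)"

text \<open>
  The list \<open>[\<rho>\<^sub>N(1), \<dots>, \<rho>\<^sub>N(N)]\<close>: first \<open>1\<close>, then the even numbers up to \<open>N\<close> increasingly, then the
  odd numbers greater than \<open>1\<close> decreasingly. Its entries are ranks counted from \<open>1\<close>, whereas list
  positions and cycle sites are counted from \<open>0\<close>.
\<close>

definition bell_order :: "nat \<Rightarrow> nat list" where
  "bell_order N = 1 # filter even [1..<N + 1] @ rev (filter (\<lambda>k. odd k \<and> 1 < k) [1..<N + 1])"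

definition decreasing_entries :: "real vec \<Rightarrow> real list" where
  "decreasing_entries x = rev (sort (list_of_vec x))"

text \<open>The placement around the cycle is fixed to start at site \<open>0\<close> in the positive direction.\<close>

definition bell :: "real vec \<Rightarrow> real vec" where
  "bell x = vec (dim_vec x) (\<lambda>i. decreasing_entries x ! (bell_order (dim_vec x) ! i - 1))"


lemma L_mat_mult_vec:
  assumes "u \<in> carrier_vec (dim_vec V)" "j < dim_vec V"
  shows "(L_mat d p V *\<^sub>v u) $ j =
    d * (exp (- p) * u $ (cyc_succ (dim_vec V) j) + exp p * u $ (cyc_pred (dim_vec V) j) - 2 * u $ j)
    + V $ j * u $ j"
proof -
  define N where "N = dim_vec V"
  have j: "j < N" "j < dim_vec V" and u: "dim_vec u = N" using assms by (auto simp: N_def)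
  have m: "cyc_succ N j < N" "cyc_pred N j < N" using j by auto
  have "(L_mat d p V *\<^sub>v u) $ j = (\<Sum>k\<in>{0..<N}. ((if k = cyc_succ N j then d * exp (- p) else 0)
      + (if k = cyc_pred N j then d * exp p else 0) + (if k = j then V $ j - 2 * d else 0)) * u $ k)"
    using j u by (simp add: L_mat_def Let_def scalar_prod_def N_def[symmetric])
  also have "\<dots> = (\<Sum>k\<in>{0..<N}. (if k = cyc_succ N j then d * exp (- p) * u $ k else 0))
      + (\<Sum>k\<in>{0..<N}. (if k = cyc_pred N j then d * exp p * u $ k else 0))
      + (\<Sum>k\<in>{0..<N}. (if k = j then (V $ j - 2 * d) * u $ k else 0))"
    unfolding sum.distrib[symmetric] by (intro sum.cong) (auto simp: algebra_simps)
  also have "\<dots> = d * exp (- p) * u $ (cyc_succ N j) + d * exp p * u $ (cyc_pred N j)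
      + (V $ j - 2 * d) * u $ j"
    using m j by (simp add: sum.delta)
  finally show ?thesis by (simp add: N_def algebra_simps)
qed

lemma bell_order_permutes: "0 < N \<Longrightarrow> mset (bell_order N) = mset [1..<N + 1]"
proof (induction N)
  case (Suc N)
  then show ?case by (cases "N = 0"; cases "even N") (auto simp: bell_order_def)
qed simp

lemma cosh_above_tangent: "cosh s + sinh s * (t - s) \<le> cosh (t :: real)"
proof -
  have "exp s * (1 + (t - s)) \<le> exp s * exp (t - s)"
    by (intro mult_left_mono exp_ge_add_one_self) auto
  moreover have "exp (- s) * (1 + (s - t)) \<le> exp (- s) * exp (s - t)"
    by (intro mult_left_mono exp_ge_add_one_self) auto
  ultimately show ?thesis
    by (simp add: cosh_def sinh_def exp_add[symmetric] field_simps)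
qed

lemma phase_energy_min_attained:
  assumes a: "a \<in> pos_unit_vecs N" and N: "0 < N"
  shows "\<exists>\<theta>\<in>phase_constraint N \<sigma>. T_fun \<sigma> a = phase_energy a \<theta> \<and>
           (\<forall>\<theta>'\<in>phase_constraint N \<sigma>. phase_energy a \<theta> \<le> phase_energy a \<theta>')"
proof -
  have dim: "dim_vec a = N" and pos: "\<And>j. j < N \<Longrightarrow> 0 < a $ j"
    using a by (auto simp: pos_unit_vecs_def)
  define w where "w j = a $ j * a $ (cyc_succ N j)" for j
  have w: "0 < w j" if "j < N" for j
    unfolding w_def using that N by (intro mult_pos_pos pos) auto
  define h where "h l = (\<Sum>j<N. arsinh (l / w j))" for l
  have cont: "isCont h l" for l
  proof -
    have "continuous_on UNIV h" unfolding h_def using w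
      by (intro continuous_intros) (auto simp: less_imp_neq[symmetric])
    then show ?thesis by (auto simp: continuous_on_eq_continuous_at)
  qed
  define l0 where "l0 = w 0 * sinh \<bar>\<sigma>\<bar>"
  have l0: "0 \<le> l0" using w[OF N] by (simp add: l0_def)
  have nonneg: "0 \<le> arsinh (l0 / w j)" if "j < N" for j
    using l0 w[OF that] arsinh_real_neg_iff[of "l0 / w j"]
    by (meson divide_nonneg_pos not_le)
  have "arsinh (l0 / w 0) \<le> h l0"
    unfolding h_def by (rule member_le_sum) (use N nonneg in auto)
  moreover have "arsinh (l0 / w 0) = \<bar>\<sigma>\<bar>"
    using w[OF N] by (simp add: l0_def arsinh_sinh_real del: sinh_real_abs)
  ultimately have up: "\<bar>\<sigma>\<bar> \<le> h l0" by simp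
  have "h (- l0) = - h l0" by (simp add: h_def sum_negf)
  then have "h (- l0) \<le> \<sigma>" "\<sigma> \<le> h l0" using up by auto
  then obtain l where l: "h l = \<sigma>"
    using IVT[of h "- l0" \<sigma> l0] l0 cont by auto
  define \<theta> where "\<theta> = vec N (\<lambda>j. arsinh (l / w j))"
  have \<theta>: "\<theta> \<in> phase_constraint N \<sigma>"
    using l by (simp add: \<theta>_def phase_constraint_def h_def)
  have le: "phase_energy a \<theta> \<le> phase_energy a t" if t: "t \<in> phase_constraint N \<sigma>" for t
  proof -
    have "(\<Sum>j<N. w j * cosh (\<theta> $ j) + l * (t $ j - \<theta> $ j)) \<le> (\<Sum>j<N. w j * cosh (t $ j))"
    proof (rule sum_mono)
      fix j assume "j \<in> {..<N}"
      then have j: "j < N" by simp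
      have "w j * (cosh (\<theta> $ j) + sinh (\<theta> $ j) * (t $ j - \<theta> $ j)) \<le> w j * cosh (t $ j)"
        using w[OF j] by (intro mult_left_mono cosh_above_tangent) auto
      moreover have "w j * sinh (\<theta> $ j) = l" using w[OF j] j by (simp add: \<theta>_def)
      ultimately show "w j * cosh (\<theta> $ j) + l * (t $ j - \<theta> $ j) \<le> w j * cosh (t $ j)"
        by (simp add: distrib_left mult.assoc[symmetric])
    qed
    moreover have "(\<Sum>j<N. l * (t $ j - \<theta> $ j)) = 0"
      using t \<theta> by (simp add: sum_distrib_left[symmetric] sum_subtractf phase_constraint_def)
    ultimately show ?thesis
      by (simp add: phase_energy_def Let_def dim w_def sum.distrib)
  qed
  have "T_fun \<sigma> a = phase_energy a \<theta>"
    unfolding T_fun_def dim by (rule Least_equality) (use \<theta> le in auto)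
  then show ?thesis using \<theta> le by blast
qed

end

theory Submission
  imports Defs
begin

text \<open>
  By convex duality \<open>T_fun \<sigma> a\<close> is the maximum over \<open>l\<close> of
  \<open>l \<sigma> + (\<Sum>j. g\<^sub>l (a\<^sub>j a\<^sub>j\<^sub>+\<^sub>1))\<close>, where \<open>g\<^sub>l (w)\<close> is the minimum over \<open>\<theta>\<close> of
  \<open>w cosh \<theta> - l \<theta>\<close>. As \<open>g\<^sub>l (exp s)\<close> is convex in \<open>s\<close>, the function \<open>g\<^sub>l (x y)\<close> is supermodular
  on positive arguments, and the sum of a symmetric supermodular function over the edges of a cycle
  is largest for the bell-shaped arrangement. The eigenvalue inequality then follows from the
  variational formula \<open>\<Lambda>\<^sub>p (V) = max\<^sub>a (2 d T_fun (- N p) a + (\<Sum>j. (V\<^sub>j - 2 d) a\<^sub>j\<^sup>2))\<close>, attained at the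
  geometric mean \<open>a = sqrt (u v)\<close> of the right and left Perron vectors, together with the
  rearrangement inequality for the potential term.
\<close>

subsection \<open>Supermodular sums over a cycle\<close>

fun path_sum :: "('a \<Rightarrow> 'a \<Rightarrow> real) \<Rightarrow> 'a list \<Rightarrow> real" where
  "path_sum F (x # y # xs) = F x y + path_sum F (y # xs)"
| "path_sum F [x] = 0"
| "path_sum F [] = 0"

text \<open>Repeating the head closes the path, so cyclic statements reduce to
  \<open>path_sum_append\<close>. For the empty list \<open>hd []\<close> is unspecified, but a
  one-element path has sum \<open>0\<close>.\<close>

definition cycle_sum :: "('a \<Rightarrow> 'a \<Rightarrow> real) \<Rightarrow> 'a list \<Rightarrow> real" where
  "cycle_sum F xs = path_sum F (xs @ [hd xs])"

lemma path_sum_append: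
  "path_sum F (xs @ y # ys) = path_sum F (xs @ [y]) + path_sum F (y # ys)"
  by (induction F xs rule: path_sum.induct) auto

lemma path_sum_conv_sum:
  "path_sum F xs = (\<Sum>j<length xs - 1. F (xs ! j) (xs ! Suc j))"
proof (induction F xs rule: path_sum.induct)
  case (1 F x y xs)
  then show ?case by (simp add: sum.lessThan_Suc_shift del: sum.lessThan_Suc)
qed auto

lemma cycle_sum_conv_sum:
  assumes "xs \<noteq> []"
  shows "cycle_sum F xs = (\<Sum>j<length xs. F (xs ! j) (xs ! cyc_succ (length xs) j))"
proof -
  have "(xs @ [hd xs]) ! Suc j = xs ! cyc_succ (length xs) j" if "j < length xs" for j
  proof (cases "Suc j = length xs")
    case True
    then show ?thesis using assms by (simp add: nth_append hd_conv_nth)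
  next
    case False
    then show ?thesis using that by (simp add: nth_append)
  qed
  then show ?thesis
    by (simp add: cycle_sum_def path_sum_conv_sum nth_append)
qed

text \<open>If both lists are nonempty, either side splits into the path from the head of
  \<open>xs\<close> to the head of \<open>ys\<close> and the path back.\<close>

lemma cycle_sum_rotate: "cycle_sum F (xs @ ys) = cycle_sum F (ys @ xs)"
proof (cases "xs = [] \<or> ys = []")
  case False
  then obtain x xs' y ys' where "xs = x # xs'" "ys = y # ys'"
    by (metis list.exhaust)
  then show ?thesis
    using path_sum_append[of F "x # xs'" y "ys' @ [x]"] path_sum_append[of F "y # ys'" x "xs' @ [y]"]
    by (simp add: cycle_sum_def)
qed auto

text \<open>The closing edge is replaced by two edges through \<open>m\<close>. For a one-element
  \<open>ys\<close> the closing edge is a loop.\<close>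

lemma cycle_sum_snoc:
  assumes "ys \<noteq> []"
  shows "cycle_sum F (ys @ [m]) =
    cycle_sum F ys + F (last ys) m + F m (hd ys) - F (last ys) (hd ys)"
proof -
  obtain zs b where ys: "ys = zs @ [b]" using assms by (metis append_butlast_last_id)
  show ?thesis
    using path_sum_append[of F zs b "[m, hd ys]"] path_sum_append[of F zs b "[hd ys]"]
    by (cases zs) (simp_all add: cycle_sum_def ys)
qed

text \<open>Even ranks run upwards and odd ranks downwards, so the two largest ranks are neighbours
  where the runs meet, and \<open>Suc N\<close> goes between them; parity decides their order.
  Writing \<open>hd (vs @ us)\<close> covers \<open>N = 2\<close>, where \<open>vs\<close> is empty
  and the gap is the closing edge.\<close>

lemma bell_order_Suc:
  assumes "2 \<le> N"
  obtains us vs where "bell_order N = us @ vs" "bell_order (Suc N) = us @ Suc N # vs" "us \<noteq> []"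
    "(last us, hd (vs @ us)) = (N - 1, N) \<or> (last us, hd (vs @ us)) = (N, N - 1)"
proof -
  obtain K where K: "N = Suc K" "0 < K" using assms by (cases N) auto
  define es where "es n = filter even [1..<n + 1]" for n
  define os where "os n = rev (filter (\<lambda>k. odd k \<and> 1 < k) [1..<n + 1])" for n
  have b: "bell_order n = 1 # es n @ os n" for n by (simp add: bell_order_def es_def os_def)
  show ?thesis
  proof (cases "even N")
    case True
    have e: "es N = es K @ [N]" "es (Suc N) = es N" and o: "os (Suc N) = Suc N # os N" "os N = os K"
      using True K by (auto simp: es_def os_def)
    have h: "hd (os K @ [1]) = K"
      using True K by (cases K) (auto simp: os_def)
    have "hd (os N @ 1 # es N) = K"
      using h by (cases "os K") (auto simp: o)
    then show ?thesis
      using e o K by (intro that[of "1 # es N" "os N"]) (auto simp: b)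
  next
    case False
    have e: "es (Suc N) = es N @ [Suc N]" "es N = es K" and o: "os (Suc N) = os N" "os N = N # os K"
      using False K by (auto simp: es_def os_def)
    have "last (1 # es N) = K"
      using False K by (cases K) (auto simp: es_def)
    then show ?thesis
      using e o K by (intro that[of "1 # es N" "os N"]) (auto simp: b)
  qed
qed

text \<open>Rotation moves the gap of \<open>bell_order_Suc\<close> to the end of the list, where
  \<open>cycle_sum_snoc\<close> gives the gain; symmetry of \<open>F\<close> removes the dependence
  on parity.\<close>

lemma cycle_sum_bell_order_Suc:
  assumes "2 \<le> N" and sym: "\<And>x y. F x y = F y x"
  shows "cycle_sum F (map f (bell_order (Suc N))) = cycle_sum F (map f (bell_order N))
    + F (f (N - 1)) (f (Suc N)) + F (f (Suc N)) (f N) - F (f (N - 1)) (f N)"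
proof -
  obtain us vs where *: "bell_order N = us @ vs" "bell_order (Suc N) = us @ Suc N # vs" "us \<noteq> []"
    "(last us, hd (vs @ us)) = (N - 1, N) \<or> (last us, hd (vs @ us)) = (N, N - 1)"
    using bell_order_Suc[OF assms(1)] .
  define ys where "ys = map f (vs @ us)"
  have "last ys = f (last us)" "hd ys = f (hd (vs @ us))" "ys \<noteq> []"
    unfolding ys_def using *(3) by (auto simp: last_map hd_map simp del: map_append)
  moreover have "cycle_sum F (map f (bell_order (Suc N))) = cycle_sum F (ys @ [f (Suc N)])"
    using cycle_sum_rotate[of F "map f us @ [f (Suc N)]" "map f vs"] by (simp add: ys_def *(2))
  moreover have "cycle_sum F (map f (bell_order N)) = cycle_sum F ys"
    using cycle_sum_rotate[of F "map f us" "map f vs"] by (simp add: ys_def *(1))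
  ultimately show ?thesis
    using *(4) sym by (auto simp: cycle_sum_snoc)
qed

text \<open>First \<open>b\<close> is lowered to \<open>b'\<close> with \<open>c\<close> fixed, then
  \<open>c\<close> to \<open>c'\<close> with \<open>b'\<close> fixed; each move is one use of
  supermodularity against \<open>m\<close>.\<close>

lemma supermodular_insertion_le:
  fixes F :: "'a::linorder \<Rightarrow> 'a \<Rightarrow> real"
  assumes sym: "\<And>x y. F x y = F y x"
    and super: "\<And>x x' y y'. \<lbrakk>x \<in> S; x' \<in> S; y \<in> S; y' \<in> S; x \<le> x'; y \<le> y'\<rbrakk>
      \<Longrightarrow> F x y' + F x' y \<le> F x y + F x' y'"
    and S: "m \<in> S" "b \<in> S" "b' \<in> S" "c \<in> S" "c' \<in> S"
    and le: "m \<le> b'" "b' \<le> b" "m \<le> c'" "c' \<le> c"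
  shows "F b m + F m c - F b c \<le> F b' m + F m c' - F b' c'"
proof -
  have "F b' c + F b m \<le> F b' m + F b c"
    using super[of b' b m c] S le by simp
  moreover have "F c' b' + F c m \<le> F c' m + F c b'"
    using super[of c' c m b'] S le by simp
  ultimately show ?thesis
    using sym[of c' b'] sym[of c m] sym[of c' m] sym[of c b'] by linarith
qed

text \<open>The cycle is built by inserting the entries in decreasing order: the gain of inserting a
  smallest entry \<open>m\<close> between \<open>b\<close> and \<open>c\<close> is decreasing in \<open>b\<close> and \<open>c\<close>, hence largest when these are
  the two smallest entries already present, which is where \<^const>\<open>bell_order\<close> inserts it.\<close>

lemma cycle_sum_le_bell_order:
  fixes F :: "'a::linorder \<Rightarrow> 'a \<Rightarrow> real"
  assumes sym: "\<And>x y. F x y = F y x"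
    and super: "\<And>x x' y y'. \<lbrakk>x \<in> S; x' \<in> S; y \<in> S; y' \<in> S; x \<le> x'; y \<le> y'\<rbrakk>
      \<Longrightarrow> F x y' + F x' y \<le> F x y + F x' y'"
    and "2 \<le> N"
    and "\<And>i j. \<lbrakk>1 \<le> i; i \<le> j; j \<le> N\<rbrakk> \<Longrightarrow> f j \<le> f i"
    and "\<And>i. \<lbrakk>1 \<le> i; i \<le> N\<rbrakk> \<Longrightarrow> f i \<in> S"
    and "mset xs = mset (map f [1..<N + 1])"
  shows "cycle_sum F xs \<le> cycle_sum F (map f (bell_order N))"
  using assms(3-)
proof (induction N arbitrary: xs rule: dec_induct)
  case base
  have "mset xs = {#f 1, f 2#}" using base by (simp add: numeral_2_eq_2)
  moreover from this have "length xs = 2" by (metis size_mset size_add_mset size_empty numeral_2_eq_2)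
  then obtain x y where "xs = [x, y]" by (auto simp: numeral_2_eq_2 length_Suc_conv)
  ultimately have "xs = [f 1, f 2] \<or> xs = [f 2, f 1]" by (auto simp: add_eq_conv_ex)
  then show ?case using sym by (auto simp: cycle_sum_def bell_order_def numeral_2_eq_2)
next
  case (step N)
  define m where "m = f (Suc N)"
  have "m \<in># mset xs" using step.prems(3) by (simp add: m_def)
  then obtain us vs where xs: "xs = us @ m # vs" by (auto dest: split_list)
  \<comment> \<open>Cutting the cycle at the smallest entry and dropping it leaves a list for the
    induction hypothesis, with \<open>m\<close> between its last and first entries.\<close>
  define ys where "ys = vs @ us"
  have ys: "mset ys = mset (map f [1..<N + 1])"
  proof -
    have "mset xs = add_mset m (mset ys)" by (simp add: xs ys_def)
    moreover have "mset (map f [1..<Suc N + 1]) = add_mset m (mset (map f [1..<N + 1]))"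
      by (simp add: m_def)
    ultimately show ?thesis using step.prems(3) by simp
  qed
  then have len: "length ys = N" by (metis size_mset length_map length_upt diff_add_inverse2)
  then obtain c zs where zs: "ys = c # zs" using step.hyps by (cases ys) auto
  then have "zs \<noteq> []" using len step.hyps by auto
  then obtain ws b where w: "ys = c # ws @ [b]" using zs by (metis append_butlast_last_id)
  have cyc: "cycle_sum F xs = cycle_sum F ys + F b m + F m c - F b c"
  proof -
    have "cycle_sum F xs = cycle_sum F (ys @ [m])"
      using cycle_sum_rotate[of F "us @ [m]" vs] by (simp add: xs ys_def)
    then show ?thesis using cycle_sum_snoc[of ys F m] by (simp add: w)
  qed
  have IH: "cycle_sum F ys \<le> cycle_sum F (map f (bell_order N))"
    by (rule step.IH) (use step.prems ys in auto)
  have mem: "z \<in> S \<and> f N \<le> z" if "z \<in> {b, c}" for z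
  proof -
    have "z \<in># mset ys" using that w by auto
    then obtain i where "1 \<le> i" "i \<le> N" "z = f i" unfolding ys by auto
    then show ?thesis using step.prems(1,2) by auto
  qed
  \<comment> \<open>Among the values \<open>f 1\<close> to \<open>f N\<close> only
    \<open>f N\<close> can lie strictly below \<open>f (N - 1)\<close>, whereas \<open>b\<close> and
    \<open>c\<close> occupy two different positions of \<open>ys\<close>.\<close>
  have two: "f (N - 1) \<le> b \<or> f (N - 1) \<le> c"
  proof (rule ccontr)
    assume neg: "\<not> ?thesis"
    obtain K where K: "N = Suc K" "1 \<le> K" using step.hyps by (cases N) auto
    have e: "filter_mset (\<lambda>z. z < f K) (mset (map f [1..<K + 1])) = {#}"
      using step.prems(1) K by (auto simp: filter_mset_eq_conv not_less)
    have "size (filter_mset (\<lambda>z. z < f K) (mset ys))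
        \<le> size (filter_mset (\<lambda>z. z < f K) (mset (map f [1..<K + 1]))) + 1"
      unfolding ys K(1) by simp
    then have "size (filter_mset (\<lambda>z. z < f K) (mset ys)) \<le> 1" unfolding e by simp
    moreover have "2 \<le> size (filter_mset (\<lambda>z. z < f K) (mset ys))"
      using neg K by (simp add: w not_le)
    ultimately show False by simp
  qed
  have fm: "m \<in> S" "m \<le> f N" "m \<le> f (N - 1)" "f N \<in> S" "f (N - 1) \<in> S"
    using step.prems step.hyps by (auto simp: m_def)
  \<comment> \<open>The neighbour known to be at least \<open>f (N - 1)\<close> is lowered to that
    value, the other one to \<open>f N\<close>.\<close>
  have "F b m + F m c - F b c \<le> F (f (N - 1)) m + F m (f N) - F (f (N - 1)) (f N)"
    using two
  proof
    assume "f (N - 1) \<le> b"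
    then show ?thesis
      using mem fm by (intro supermodular_insertion_le[where S = S]) (auto simp: sym super)
  next
    assume "f (N - 1) \<le> c"
    then have "F c m + F m b - F c b \<le> F (f (N - 1)) m + F m (f N) - F (f (N - 1)) (f N)"
      using mem fm by (intro supermodular_insertion_le[where S = S]) (auto simp: sym super)
    then show ?thesis using sym[of c m] sym[of m b] sym[of c b] by linarith
  qed
  then show ?case
    using IH cyc cycle_sum_bell_order_Suc[of N F f] step.hyps sym by (simp add: m_def)
qed

section \<open>Rearrangement inequality and the entries of \<open>bell\<close>\<close>

text \<open>An exchange argument that splits off the two smallest values as a pair in each induction
  step. The multiset \<open>M\<close> encodes an arbitrary matching of the values, so no permutation
  has to be tracked.\<close>

lemma sum_mset_mult_le_antitone:
  fixes f g :: "nat \<Rightarrow> real"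
  assumes "\<And>i j. \<lbrakk>1 \<le> i; i \<le> j; j \<le> N\<rbrakk> \<Longrightarrow> f j \<le> f i"
    and "\<And>i j. \<lbrakk>1 \<le> i; i \<le> j; j \<le> N\<rbrakk> \<Longrightarrow> g j \<le> g i"
    and "image_mset fst M = image_mset f (mset_set {1..N})"
    and "image_mset snd M = image_mset g (mset_set {1..N})"
  shows "(\<Sum>(x, y)\<in>#M. x * y) \<le> (\<Sum>k=1..N. f k * g k)"
  using assms
proof (induction N arbitrary: M)
  case 0
  then show ?case by simp
next
  case (Suc N)
  have ins: "mset_set {1..Suc N} = add_mset (Suc N) (mset_set {1..N})"
    by (simp add: atLeastAtMostSuc_conv)
  have ge: "f (Suc N) \<le> x" if "x \<in># image_mset fst M" for x
    using that Suc.prems(1) unfolding Suc.prems(3) by auto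
  have ge': "g (Suc N) \<le> y" if "y \<in># image_mset snd M" for y
    using that Suc.prems(2) unfolding Suc.prems(4) by auto
  have "f (Suc N) \<in># image_mset fst M" unfolding Suc.prems(3) ins by simp
  then obtain y M' where M: "M = add_mset (f (Suc N), y) M'"
    by (auto dest!: multi_member_split)
  have fst': "image_mset fst M' = image_mset f (mset_set {1..N})"
    using Suc.prems(3) unfolding ins by (simp add: M)
  show ?case
  proof (cases "y = g (Suc N)")
    case True
    have "image_mset snd M' = image_mset g (mset_set {1..N})"
      using Suc.prems(4) unfolding ins by (simp add: M True)
    then have "(\<Sum>(x, y)\<in>#M'. x * y) \<le> (\<Sum>k=1..N. f k * g k)"
      using Suc.prems(1,2) fst' by (intro Suc.IH) auto
    then show ?thesis by (simp add: M True)
  next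
    case False
    have "g (Suc N) \<in># image_mset snd M" unfolding Suc.prems(4) ins by simp
    then have "g (Suc N) \<in># image_mset snd M'" using False by (simp add: M)
    then obtain x M'' where M': "M' = add_mset (x, g (Suc N)) M''"
      by (auto dest!: multi_member_split)
    \<comment> \<open>Swapping partners splits off \<open>(f (Suc N), g (Suc N))\<close> and leaves
      \<open>(x, y)\<close>; this raises the sum by
      \<open>(x - f (Suc N)) * (y - g (Suc N))\<close>.\<close>
    have "image_mset snd (add_mset (x, y) M'') = image_mset g (mset_set {1..N})"
      using Suc.prems(4) unfolding ins by (simp add: M M' add_mset_commute)
    moreover have "image_mset fst (add_mset (x, y) M'') = image_mset f (mset_set {1..N})"
      using fst' by (simp add: M')
    ultimately have "(\<Sum>(x, y)\<in>#add_mset (x, y) M''. x * y) \<le> (\<Sum>k=1..N. f k * g k)"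
      using Suc.prems(1,2) by (intro Suc.IH) auto
    moreover have "0 \<le> (x - f (Suc N)) * (y - g (Suc N))"
      using ge[of x] ge'[of y] by (intro mult_nonneg_nonneg) (auto simp: M M')
    ultimately show ?thesis by (simp add: M M' algebra_simps)
  qed
qed

lemma mset_entries:
  assumes "x \<in> carrier_vec N"
  shows "image_mset (\<lambda>k. decreasing_entries x ! (k - 1)) (mset [1..<N + 1]) = mset (list_of_vec x)"
proof -
  have len: "length (decreasing_entries x) = N"
    using assms by (simp add: decreasing_entries_def)
  have "map (\<lambda>k. decreasing_entries x ! (k - 1)) [1..<N + 1] = decreasing_entries x"
    by (rule nth_equalityI) (auto simp: len simp del: upt_Suc)
  then show ?thesis
    by (metis mset_map decreasing_entries_def mset_rev mset_sort)
qed

lemma decreasing_entries_antitone: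
  assumes "x \<in> carrier_vec N" "1 \<le> i" "i \<le> j" "j \<le> N"
  shows "decreasing_entries x ! (j - 1) \<le> decreasing_entries x ! (i - 1)"
  using assms by (intro sorted_rev_nth_mono) (auto simp: decreasing_entries_def)

lemma decreasing_entries_mem:
  assumes "x \<in> carrier_vec N" "1 \<le> i" "i \<le> N"
  shows "\<exists>j<N. decreasing_entries x ! (i - 1) = x $ j"
proof -
  have "decreasing_entries x ! (i - 1) \<in> set (decreasing_entries x)"
    using assms by (intro nth_mem) (auto simp: decreasing_entries_def)
  then show ?thesis using assms(1) by (auto simp: decreasing_entries_def set_list_of_vec vec_set_def)
qed

lemma length_bell_order: "0 < N \<Longrightarrow> length (bell_order N) = N"
  using arg_cong[OF bell_order_permutes, of N size] by simp

lemma list_of_vec_bell: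
  assumes "x \<in> carrier_vec N" "0 < N"
  shows "list_of_vec (bell x) = map (\<lambda>k. decreasing_entries x ! (k - 1)) (bell_order N)"
  using assms by (intro nth_equalityI) (auto simp: bell_def length_bell_order)

text \<open>Each rank occurs exactly once in \<open>bell_order N\<close>. This turns sums over the
  sites of rearranged vectors into sums over ranks.\<close>

lemma sum_bell_order:
  assumes "0 < N"
  shows "(\<Sum>j<N. h (bell_order N ! j)) = (\<Sum>k=1..N. h k :: real)"
proof -
  have "(\<Sum>j<N. h (bell_order N ! j)) = sum_list (map h (bell_order N))"
    using assms by (simp add: sum_list_sum_nth length_bell_order atLeast0LessThan)
  also have "\<dots> = sum_mset (image_mset h (mset (bell_order N)))"
    by (metis mset_map sum_mset_sum_list)
  also have "\<dots> = sum_mset (image_mset h (mset [1..<N + 1]))"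
    using bell_order_permutes[OF assms] by simp
  also have "\<dots> = (\<Sum>k=1..N. h k)"
    by (metis mset_map sum_mset_sum_list sum_set_upt_conv_sum_list_nat set_upt atLeastLessThanSuc_atLeastAtMost Suc_eq_plus1)
  finally show ?thesis .
qed

lemma sum_entries_bell:
  assumes "x \<in> carrier_vec N" "0 < N"
  shows "(\<Sum>j<N. h (bell x $ j)) = (\<Sum>j<N. h (x $ j) :: real)"
proof -
  have "(\<Sum>j<N. h (bell x $ j)) = (\<Sum>k=1..N. h (decreasing_entries x ! (k - 1)))"
    using assms sum_bell_order[OF assms(2), of "\<lambda>k. h (decreasing_entries x ! (k - 1))"]
    by (simp add: bell_def)
  also have "\<dots> = sum_mset (image_mset h (image_mset (\<lambda>k. decreasing_entries x ! (k - 1)) (mset [1..<N + 1])))"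
    by (simp add: image_mset.compositionality comp_def sum_unfold_sum_mset atLeastLessThanSuc_atLeastAtMost del: upt_Suc)
  also have "\<dots> = sum_list (map h (list_of_vec x))"
    unfolding mset_entries[OF assms(1)] by (metis mset_map sum_mset_sum_list)
  also have "\<dots> = (\<Sum>j<N. h (x $ j))"
    using assms by (simp add: sum_list_sum_nth atLeast0LessThan)
  finally show ?thesis .
qed

lemma bell_carrier: "x \<in> carrier_vec N \<Longrightarrow> bell x \<in> carrier_vec N"
  by (auto simp: bell_def)

lemma bell_pos_unit_vecs:
  assumes a: "a \<in> pos_unit_vecs N" and "0 < N"
  shows "bell a \<in> pos_unit_vecs N"
proof -
  have ca: "a \<in> carrier_vec N" and pos: "\<And>j. j < N \<Longrightarrow> 0 < a $ j" and "(\<Sum>j<N. (a $ j)\<^sup>2) = 1"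
    using a by (auto simp: pos_unit_vecs_def)
  moreover have "0 < bell a $ j" if j: "j < N" for j
  proof -
    have "bell_order N ! j \<in># mset (bell_order N)" using j by (simp add: length_bell_order)
    then have "1 \<le> bell_order N ! j" "bell_order N ! j \<le> N"
      unfolding bell_order_permutes[OF \<open>0 < N\<close>] by auto
    then show ?thesis
      using decreasing_entries_mem[OF ca] pos j ca by (force simp: bell_def)
  qed
  ultimately show ?thesis
    using sum_entries_bell[OF ca \<open>0 < N\<close>, of "\<lambda>t. t\<^sup>2"] bell_carrier[OF ca]
    by (auto simp: pos_unit_vecs_def)
qed

text \<open>The same \<open>bell_order\<close> arranges both vectors, so large entries of
  \<open>V\<close> meet large entries of \<open>b\<close>; nonnegativity makes squaring preserve the
  order of the entries of \<open>b\<close>.\<close>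

lemma sum_mult_power2_le_bell:
  assumes V: "V \<in> carrier_vec N" and b: "b \<in> carrier_vec N" "\<And>j. j < N \<Longrightarrow> 0 \<le> b $ j" and "0 < N"
  shows "(\<Sum>j<N. V $ j * (b $ j)\<^sup>2) \<le> (\<Sum>j<N. bell V $ j * (bell b $ j)\<^sup>2)"
proof -
  define f where "f k = decreasing_entries V ! (k - 1)" for k
  define g where "g k = (decreasing_entries b ! (k - 1))\<^sup>2" for k
  define M where "M = image_mset (\<lambda>j. (V $ j, (b $ j)\<^sup>2)) (mset_set {0..<N})"
  have entries: "image_mset (\<lambda>k. decreasing_entries x ! (k - 1)) (mset_set {1..N})
      = image_mset (($) x) (mset_set {0..<N})" if "x \<in> carrier_vec N" for x :: "real vec"
  proof -
    have "list_of_vec x = map (($) x) [0..<N]"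
      using that by (intro nth_equalityI) auto
    then have "mset (list_of_vec x) = image_mset (($) x) (mset_set {0..<N})" by simp
    then show ?thesis
      using mset_entries[OF that] by (simp add: atLeastLessThanSuc_atLeastAtMost del: upt_Suc)
  qed
  have "(\<Sum>(x, y)\<in>#M. x * y) \<le> (\<Sum>k=1..N. f k * g k)"
  proof (rule sum_mset_mult_le_antitone)
    show "f j \<le> f i" if "1 \<le> i" "i \<le> j" "j \<le> N" for i j
      unfolding f_def using that by (rule decreasing_entries_antitone[OF V])
    show "g j \<le> g i" if ij: "1 \<le> i" "i \<le> j" "j \<le> N" for i j
    proof -
      have "0 \<le> decreasing_entries b ! (j - 1)"
        using decreasing_entries_mem[OF b(1), of j] b(2) ij by auto
      then show ?thesis
        unfolding g_def using decreasing_entries_antitone[OF b(1) ij] by (intro power_mono)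
    qed
    show "image_mset fst M = image_mset f (mset_set {1..N})"
      using entries[OF V] by (simp add: M_def f_def[abs_def] image_mset.compositionality comp_def)
    have "image_mset g (mset_set {1..N}) = image_mset (\<lambda>t. t\<^sup>2)
        (image_mset (\<lambda>k. decreasing_entries b ! (k - 1)) (mset_set {1..N}))"
      by (simp add: g_def[abs_def] image_mset.compositionality comp_def)
    then show "image_mset snd M = image_mset g (mset_set {1..N})"
      unfolding entries[OF b(1)] by (simp add: M_def image_mset.compositionality comp_def)
  qed
  moreover have "(\<Sum>(x, y)\<in>#M. x * y) = (\<Sum>j<N. V $ j * (b $ j)\<^sup>2)"
    by (simp add: M_def image_mset.compositionality comp_def sum_unfold_sum_mset atLeast0LessThan)
  moreover have "(\<Sum>j<N. bell V $ j * (bell b $ j)\<^sup>2) = (\<Sum>k=1..N. f k * g k)"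
    using V b sum_bell_order[OF \<open>0 < N\<close>, of "\<lambda>k. f k * g k"] by (simp add: bell_def f_def g_def)
  ultimately show ?thesis by simp
qed

subsection \<open>Perron vectors\<close>

text \<open>A Gershgorin bound after rescaling by \<open>u\<close>: all rescaled rows sum to
  \<open>\<mu>\<close>, so the disc of row \<open>j\<close> has centre \<open>A $$ (j, j)\<close>
  and radius \<open>\<mu> - A $$ (j, j)\<close> and contains no point with real part above
  \<open>\<mu>\<close>.\<close>

lemma spectral_bound_eqI:
  fixes A :: "real mat"
  assumes A: "A \<in> carrier_mat n n" and "0 < n"
    and off: "\<And>i j. \<lbrakk>i < n; j < n; i \<noteq> j\<rbrakk> \<Longrightarrow> 0 \<le> A $$ (i, j)"
    and u: "u \<in> carrier_vec n" "\<And>i. i < n \<Longrightarrow> 0 < u $ i"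
    and ev: "A *\<^sub>v u = \<mu> \<cdot>\<^sub>v u"
  shows "spectral_bound A = \<mu>"
proof -
  let ?B = "map_mat complex_of_real A"
  have B: "?B \<in> carrier_mat n n" using A by simp
  have "u \<noteq> 0\<^sub>v n" using u(2)[OF \<open>0 < n\<close>] \<open>0 < n\<close> by auto
  then have "eigenvector A u \<mu>" using A u ev by (simp add: eigenvector_def)
  then have "eigenvector ?B (map_vec complex_of_real u) (complex_of_real \<mu>)"
    using of_real_hom.eigenvector_hom[OF A] by auto
  then have mem: "complex_of_real \<mu> \<in> spectrum ?B"
    by (auto simp: spectrum_def eigenvalue_def)
  have "Re z \<le> \<mu>" if z: "z \<in> spectrum ?B" for z
  proof -
    obtain w where w: "w \<in> carrier_vec n" "w \<noteq> 0\<^sub>v n" and Bw: "?B *\<^sub>v w = z \<cdot>\<^sub>v w"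
      using z A by (auto simp: spectrum_def eigenvalue_def eigenvector_def)
    \<comment> \<open>The sup norm of \<open>w\<close> weighted by \<open>u\<close>; the row
      \<open>j\<close> where it is attained is the one to estimate.\<close>
    define r where "r = (MAX i\<in>{..<n}. cmod (w $ i) / u $ i)"
    have "r \<in> (\<lambda>i. cmod (w $ i) / u $ i) ` {..<n}"
      unfolding r_def using \<open>0 < n\<close> by (intro Max_in) auto
    then obtain j where j: "j < n" "r = cmod (w $ j) / u $ j" by auto
    have le: "cmod (w $ i) \<le> r * u $ i" if "i < n" for i
    proof -
      have "cmod (w $ i) / u $ i \<le> r" unfolding r_def using that by (intro Max_ge) auto
      then show ?thesis using u(2)[OF that] by (simp add: field_simps)
    qed
    obtain k where "k < n" "w $ k \<noteq> 0" using w by (metis eq_vecI carrier_vecD index_zero_vec)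
    then have "0 < r * u $ k" using le[of k] by (smt (verit) zero_less_norm_iff)
    then have "0 < r" using u(2)[OF \<open>k < n\<close>] by (simp add: zero_less_mult_iff)
    then have wj: "0 < cmod (w $ j)" using j u(2)[OF j(1)] by (auto simp: zero_less_divide_iff)
    have "(\<Sum>k\<in>{0..<n}. complex_of_real (A $$ (j, k)) * w $ k) = z * w $ j"
      using arg_cong[OF Bw, of "\<lambda>v. v $ j"] A j w by (simp add: scalar_prod_def)
    moreover have "(\<Sum>k\<in>{0..<n}. complex_of_real (A $$ (j, k)) * w $ k) =
        complex_of_real (A $$ (j, j)) * w $ j + (\<Sum>k\<in>{0..<n} - {j}. complex_of_real (A $$ (j, k)) * w $ k)"
      using j by (intro sum.remove) auto
    ultimately have "(z - complex_of_real (A $$ (j, j))) * w $ j =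
        (\<Sum>k\<in>{0..<n} - {j}. complex_of_real (A $$ (j, k)) * w $ k)"
      by (simp add: algebra_simps)
    then have "cmod (z - complex_of_real (A $$ (j, j))) * cmod (w $ j) \<le>
        (\<Sum>k\<in>{0..<n} - {j}. cmod (complex_of_real (A $$ (j, k)) * w $ k))"
      by (metis norm_mult norm_sum)
    also have "\<dots> \<le> (\<Sum>k\<in>{0..<n} - {j}. A $$ (j, k) * (r * u $ k))"
      using off j(1) le by (intro sum_mono) (auto simp: norm_mult intro!: mult_mono)
    also have "\<dots> = r * (\<Sum>k\<in>{0..<n} - {j}. A $$ (j, k) * u $ k)"
      by (simp add: sum_distrib_left algebra_simps)
    also have "(\<Sum>k\<in>{0..<n} - {j}. A $$ (j, k) * u $ k) = (\<mu> - A $$ (j, j)) * u $ j"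
    proof -
      have "(\<Sum>k\<in>{0..<n}. A $$ (j, k) * u $ k) = \<mu> * u $ j"
        using arg_cong[OF ev, of "\<lambda>v. v $ j"] A j u by (simp add: scalar_prod_def)
      moreover have "(\<Sum>k\<in>{0..<n}. A $$ (j, k) * u $ k) =
          A $$ (j, j) * u $ j + (\<Sum>k\<in>{0..<n} - {j}. A $$ (j, k) * u $ k)"
        using j by (intro sum.remove) auto
      ultimately show ?thesis by (simp add: algebra_simps)
    qed
    also have "r * ((\<mu> - A $$ (j, j)) * u $ j) = (\<mu> - A $$ (j, j)) * cmod (w $ j)"
      using j u(2)[OF j(1)] by simp
    finally have "cmod (z - complex_of_real (A $$ (j, j))) \<le> \<mu> - A $$ (j, j)"
      using wj by simp
    then show ?thesis
      using complex_Re_le_cmod[of "z - complex_of_real (A $$ (j, j))"] by simp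
  qed
  then show ?thesis
    unfolding spectral_bound_def using mem card_finite_spectrum(1)[OF B]
    by (intro Max_eqI) (auto simp: image_iff intro!: bexI[OF _ mem])
qed

text \<open>An eigenvalue of the scaled matrix, divided by \<open>c\<close>, is an eigenvalue of
  \<open>A\<close> with the same eigenvector.\<close>

lemma spectral_radius_smult_le:
  assumes "A \<in> carrier_mat n n" "0 < n" "0 < c"
  shows "spectral_radius (complex_of_real c \<cdot>\<^sub>m A) \<le> c * spectral_radius A"
proof -
  have cA: "complex_of_real c \<cdot>\<^sub>m A \<in> carrier_mat n n" using assms by simp
  obtain z where z: "z \<in> spectrum (complex_of_real c \<cdot>\<^sub>m A)"
    "spectral_radius (complex_of_real c \<cdot>\<^sub>m A) = cmod z"
    using spectral_radius_mem_max(1)[OF cA assms(2)] by auto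
  then obtain w where w: "w \<in> carrier_vec n" "w \<noteq> 0\<^sub>v n"
    and ev: "(complex_of_real c \<cdot>\<^sub>m A) *\<^sub>v w = z \<cdot>\<^sub>v w"
    using assms by (auto simp: spectrum_def eigenvalue_def eigenvector_def)
  have "A *\<^sub>v w = (z / complex_of_real c) \<cdot>\<^sub>v w"
  proof (rule eq_vecI)
    fix i assume "i < dim_vec ((z / complex_of_real c) \<cdot>\<^sub>v w)"
    then have i: "i < n" using w by simp
    have "complex_of_real c * (row A i \<bullet> w) = z * w $ i"
      using arg_cong[OF ev, of "\<lambda>v. v $ i"] assms i w by simp
    then show "(A *\<^sub>v w) $ i = ((z / complex_of_real c) \<cdot>\<^sub>v w) $ i"
      using assms i w by (simp add: field_simps)
  qed (use assms w in auto)
  then have "z / complex_of_real c \<in> spectrum A"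
    using w assms by (auto simp: spectrum_def eigenvalue_def eigenvector_def)
  then have "cmod (z / complex_of_real c) \<le> spectral_radius A"
    by (intro spectral_radius_mem_max(2)[OF assms(1,2)]) auto
  then show ?thesis using assms z by (simp add: norm_divide field_simps)
qed

text \<open>If \<open>A y \<ge> r y\<close> with \<open>r\<close> above the spectral radius, then \<open>A\<^sup>k y\<close> grows faster than the powers
  of \<open>A / c\<close>, which are bounded for \<open>c\<close> strictly between, allow.\<close>

lemma subinvariance_le_spectral_radius:
  fixes A :: "real mat"
  assumes A: "A \<in> carrier_mat n n" and "0 < n"
    and nonneg: "\<And>i j. \<lbrakk>i < n; j < n\<rbrakk> \<Longrightarrow> 0 \<le> A $$ (i, j)"
    and y: "y \<in> carrier_vec n" "\<And>i. i < n \<Longrightarrow> 0 < y $ i"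
    and ge: "\<And>i. i < n \<Longrightarrow> r * y $ i \<le> (A *\<^sub>v y) $ i"
  shows "r \<le> spectral_radius (map_mat complex_of_real A)"
proof (rule ccontr)
  let ?\<rho> = "spectral_radius (map_mat complex_of_real A)"
  assume "\<not> r \<le> ?\<rho>"
  then have lt: "?\<rho> < r" by simp
  have B: "map_mat complex_of_real A \<in> carrier_mat n n" using A by simp
  have "0 \<le> ?\<rho>" using spectral_radius_mem_max(1)[OF B \<open>0 < n\<close>] by auto
  define c where "c = (?\<rho> + r) / 2"
  have c: "0 < c" "?\<rho> < c" "c < r" using lt \<open>0 \<le> ?\<rho>\<close> by (auto simp: c_def)
  define C where "C = (1 / c) \<cdot>\<^sub>m A"
  have C: "C \<in> carrier_mat n n" using A by (simp add: C_def)
  have mapC: "map_mat complex_of_real C = complex_of_real (1 / c) \<cdot>\<^sub>m map_mat complex_of_real A"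
    using A by (auto simp: C_def)
  have "spectral_radius (map_mat complex_of_real C) \<le> (1 / c) * ?\<rho>"
    unfolding mapC using B \<open>0 < n\<close> c by (intro spectral_radius_smult_le) auto
  also have "\<dots> < 1" using c by simp
  finally have "\<exists>b. \<forall>k. norm_bound (map_mat complex_of_real C ^\<^sub>m k) b"
    using C by (intro spectral_radius_jnf_norm_bound_less_1_upper_triangular) auto
  then obtain b where b: "norm_bound (map_mat complex_of_real C ^\<^sub>m k) b" for k by auto
  have bound: "(C ^\<^sub>m k) $$ (i, j) \<le> b" if "i < n" "j < n" for i j k
  proof -
    have "map_mat complex_of_real C ^\<^sub>m k = map_mat complex_of_real (C ^\<^sub>m k)"
      by (rule of_real_hom.mat_hom_pow[OF C, symmetric])
    then have "norm_bound (map_mat complex_of_real (C ^\<^sub>m k)) b" using b[of k] by simp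
    moreover have "dim_row (C ^\<^sub>m k) = n" "dim_col (C ^\<^sub>m k) = n" using C by simp_all
    ultimately have "cmod (complex_of_real ((C ^\<^sub>m k) $$ (i, j))) \<le> b"
      using that unfolding norm_bound_def index_map_mat by simp
    then show ?thesis by simp
  qed
  define q where "q = r / c"
  have q: "1 < q" using c by (simp add: q_def)
  have nonnegC: "0 \<le> C $$ (i, j)" if "i < n" "j < n" for i j
    using that nonneg A c by (simp add: C_def)
  have grow: "q ^ k * y $ i \<le> (C ^\<^sub>m k *\<^sub>v y) $ i" if "i < n" for i k
    using that
  proof (induction k arbitrary: i)
    case 0
    then show ?case using C y by simp
  next
    case (Suc k)
    have Ck: "C ^\<^sub>m k \<in> carrier_mat n n" using C by simp
    have Cy: "q * y $ i \<le> (C *\<^sub>v y) $ i" if "i < n" for i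
      using ge[OF that] that A y c by (simp add: C_def q_def divide_right_mono)
    have pos: "0 \<le> (C ^\<^sub>m k) $$ (i, j)" if "i < n" "j < n" for i j
      using that
    proof (induction k arbitrary: i j)
      case 0
      then show ?case using C by simp
    next
      case (Suc k)
      have "C ^\<^sub>m k \<in> carrier_mat n n" using C by simp
      then show ?case
        using Suc C nonnegC by (auto simp: scalar_prod_def intro!: sum_nonneg)
    qed
    \<comment> \<open>Nonnegative entries of \<open>C ^\<^sub>m k\<close> allow the bound
      \<open>Cy\<close> to be applied underneath this power.\<close>
    have "q ^ Suc k * y $ i \<le> q * (C ^\<^sub>m k *\<^sub>v y) $ i"
      using Suc q by (simp add: mult.assoc)
    also have "\<dots> = (\<Sum>j\<in>{0..<n}. (C ^\<^sub>m k) $$ (i, j) * (q * y $ j))"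
      using carrier_matD[OF Ck] y Suc.prems by (simp add: scalar_prod_def sum_distrib_left algebra_simps)
    also have "\<dots> \<le> (\<Sum>j\<in>{0..<n}. (C ^\<^sub>m k) $$ (i, j) * (C *\<^sub>v y) $ j)"
      using pos Cy Suc.prems by (intro sum_mono mult_left_mono) auto
    also have "\<dots> = (C ^\<^sub>m k *\<^sub>v (C *\<^sub>v y)) $ i"
      using carrier_matD[OF Ck] C y Suc.prems by (simp add: scalar_prod_def)
    also have "C ^\<^sub>m k *\<^sub>v (C *\<^sub>v y) = C ^\<^sub>m Suc k *\<^sub>v y"
      using assoc_mult_mat_vec[OF Ck C y(1)] by simp
    finally show ?case .
  qed
  \<comment> \<open>For this \<open>k\<close> the lower bound \<open>grow\<close> at index
    \<open>0\<close> exceeds what entries bounded by \<open>b\<close> can produce.\<close>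
  obtain k where k: "(b * (\<Sum>j\<in>{0..<n}. y $ j)) / y $ 0 < q ^ k"
    using real_arch_pow[OF q] by blast
  have "q ^ k * y $ 0 \<le> (C ^\<^sub>m k *\<^sub>v y) $ 0" using grow \<open>0 < n\<close> .
  also have "\<dots> = (\<Sum>j\<in>{0..<n}. (C ^\<^sub>m k) $$ (0, j) * y $ j)"
  proof -
    have Ck: "C ^\<^sub>m k \<in> carrier_mat n n" using C by simp
    show ?thesis using carrier_matD[OF Ck] y \<open>0 < n\<close> by (simp add: scalar_prod_def)
  qed
  also have "\<dots> \<le> (\<Sum>j\<in>{0..<n}. b * y $ j)"
    using bound y(2) \<open>0 < n\<close> by (intro sum_mono mult_right_mono) (auto intro: less_imp_le)
  finally show False using k y(2)[OF \<open>0 < n\<close>] by (simp add: sum_distrib_left field_simps)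
qed

text \<open>The moduli \<open>x\<close> of an eigenvector for the spectral radius satisfy
  \<open>A x \<ge> \<rho> x\<close>. If equality failed, \<open>A ^\<^sub>m m\<close> would make the
  excess \<open>e\<close> positive everywhere, and \<open>y = A ^\<^sub>m m x\<close> would violate
  \<open>subinvariance_le_spectral_radius\<close>. Hence \<open>y\<close> is a positive
  eigenvector.\<close>

lemma perron_eigenvector:
  fixes A :: "real mat"
  assumes A: "A \<in> carrier_mat n n" and "0 < n"
    and nonneg: "\<And>i j. \<lbrakk>i < n; j < n\<rbrakk> \<Longrightarrow> 0 \<le> A $$ (i, j)"
    and prim: "\<And>x i. \<lbrakk>x \<in> carrier_vec n; x \<noteq> 0\<^sub>v n; \<And>j. j < n \<Longrightarrow> 0 \<le> x $ j; i < n\<rbrakk>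
      \<Longrightarrow> 0 < (A ^\<^sub>m m *\<^sub>v x) $ i"
  obtains r u where "u \<in> carrier_vec n" "\<And>i. i < n \<Longrightarrow> 0 < u $ i" "A *\<^sub>v u = r \<cdot>\<^sub>v u"
proof -
  let ?B = "map_mat complex_of_real A"
  let ?\<rho> = "spectral_radius ?B"
  have B: "?B \<in> carrier_mat n n" using A by simp
  obtain z where z: "z \<in> spectrum ?B" "?\<rho> = cmod z"
    using spectral_radius_mem_max(1)[OF B \<open>0 < n\<close>] by auto
  then obtain w where w: "w \<in> carrier_vec n" "w \<noteq> 0\<^sub>v n" and Bw: "?B *\<^sub>v w = z \<cdot>\<^sub>v w"
    using A by (auto simp: spectrum_def eigenvalue_def eigenvector_def)
  define x where "x = vec n (\<lambda>i. cmod (w $ i))"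
  have x: "x \<in> carrier_vec n" "\<And>j. j < n \<Longrightarrow> 0 \<le> x $ j" by (auto simp: x_def)
  have x0: "x \<noteq> 0\<^sub>v n"
  proof
    assume x0: "x = 0\<^sub>v n"
    have "w $ i = 0" if "i < n" for i
    proof -
      have "x $ i = 0" using that by (simp add: x0)
      then show ?thesis using that by (simp add: x_def)
    qed
    then show False using w by (auto intro!: eq_vecI)
  qed
  have Ax: "?\<rho> * x $ i \<le> (A *\<^sub>v x) $ i" if "i < n" for i
  proof -
    have "(\<Sum>k\<in>{0..<n}. complex_of_real (A $$ (i, k)) * w $ k) = z * w $ i"
      using arg_cong[OF Bw, of "\<lambda>v. v $ i"] A that w by (simp add: scalar_prod_def)
    then have "?\<rho> * x $ i \<le> (\<Sum>k\<in>{0..<n}. cmod (complex_of_real (A $$ (i, k)) * w $ k))"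
      using that by (simp add: x_def z norm_mult[symmetric] norm_sum del: of_real_mult)
        (metis norm_sum)
    also have "\<dots> = (A *\<^sub>v x) $ i"
      using that A nonneg by (simp add: scalar_prod_def x_def norm_mult)
    finally show ?thesis .
  qed
  have Am: "A ^\<^sub>m m \<in> carrier_mat n n" using A by simp
  define y where "y = A ^\<^sub>m m *\<^sub>v x"
  have y: "y \<in> carrier_vec n" "\<And>i. i < n \<Longrightarrow> 0 < y $ i"
    using prim[OF x(1) x0 x(2)] Am by (auto simp: y_def intro!: carrier_vecI)
  define e where "e = A *\<^sub>v x - ?\<rho> \<cdot>\<^sub>v x"
  have e: "e \<in> carrier_vec n" using A x by (auto simp: e_def)
  have e': "0 \<le> e $ j" if "j < n" for j using Ax[OF that] that A x(1) by (simp add: e_def)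
  have comm: "A *\<^sub>v y = A ^\<^sub>m m *\<^sub>v (A *\<^sub>v x)"
  proof -
    have "A * A ^\<^sub>m m = A ^\<^sub>m m * A"
      using A by (induction m) (auto simp: assoc_mult_mat[of _ n n _ n _ n, symmetric])
    then show ?thesis
      using assoc_mult_mat_vec[OF A Am x(1)] assoc_mult_mat_vec[OF Am A x(1)] by (simp add: y_def)
  qed
  have Ay: "A *\<^sub>v y = ?\<rho> \<cdot>\<^sub>v y + A ^\<^sub>m m *\<^sub>v e"
  proof -
    have "A *\<^sub>v x = ?\<rho> \<cdot>\<^sub>v x + e" using A x(1) by (auto simp: e_def)
    then show ?thesis
      unfolding comm using mult_add_distrib_mat_vec[OF Am _ e, of "?\<rho> \<cdot>\<^sub>v x"]
        mult_mat_vec[OF Am x(1)] x(1) by (simp add: y_def)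
  qed
  have "e = 0\<^sub>v n"
  proof (rule ccontr)
    assume "e \<noteq> 0\<^sub>v n"
    then have pos: "0 < (A ^\<^sub>m m *\<^sub>v e) $ i" if "i < n" for i using prim e e' that by blast
    \<comment> \<open>The largest factor for which the propagated excess still dominates
      \<open>\<epsilon> y\<close>.\<close>
    define \<epsilon> where "\<epsilon> = (MIN i\<in>{..<n}. (A ^\<^sub>m m *\<^sub>v e) $ i / y $ i)"
    have "\<epsilon> \<in> (\<lambda>i. (A ^\<^sub>m m *\<^sub>v e) $ i / y $ i) ` {..<n}"
      unfolding \<epsilon>_def using \<open>0 < n\<close> by (intro Min_in) auto
    then have "0 < \<epsilon>" using pos y(2) by auto
    have "(?\<rho> + \<epsilon>) * y $ i \<le> (A *\<^sub>v y) $ i" if "i < n" for i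
    proof -
      have "\<epsilon> \<le> (A ^\<^sub>m m *\<^sub>v e) $ i / y $ i" unfolding \<epsilon>_def using that by (intro Min_le) auto
      then have "\<epsilon> * y $ i \<le> (A ^\<^sub>m m *\<^sub>v e) $ i" using y(2)[OF that] by (simp add: field_simps)
      then show ?thesis unfolding Ay using that y(1) carrier_matD[OF Am] by (simp add: distrib_right)
    qed
    then have "?\<rho> + \<epsilon> \<le> ?\<rho>"
      using y by (intro subinvariance_le_spectral_radius[OF A \<open>0 < n\<close> nonneg]) auto
    then show False using \<open>0 < \<epsilon>\<close> by simp
  qed
  moreover have "A ^\<^sub>m m *\<^sub>v 0\<^sub>v n = 0\<^sub>v n"
    using carrier_matD[OF Am] by (auto intro!: eq_vecI simp: scalar_prod_def)
  ultimately have "A *\<^sub>v y = ?\<rho> \<cdot>\<^sub>v y" using Ay y(1) by simp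
  then show ?thesis using that y by blast
qed

section \<open>Cyclic shifts and the Perron vector of \<open>L_mat\<close>\<close>

lemma cyc_pred_succ: "j < N \<Longrightarrow> cyc_pred N (cyc_succ N j) = j"
  by (cases "Suc j = N") auto

lemma sum_cyc_succ: "(\<Sum>j<N. f (cyc_succ N j)) = (\<Sum>j<N. f j :: real)"
proof (cases N)
  case (Suc K)
  have "(\<Sum>j<N. f (cyc_succ N j)) = (\<Sum>j<K. f (Suc j)) + f 0"
    by (simp add: Suc)
  then show ?thesis by (simp add: Suc sum.lessThan_Suc_shift del: sum.lessThan_Suc)
qed simp

lemma L_mat_carrier: "V \<in> carrier_vec N \<Longrightarrow> L_mat d p V \<in> carrier_mat N N"
  by (auto simp: L_mat_def Let_def)

lemma L_mat_off_diag_nonneg: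
  assumes "V \<in> carrier_vec N" "0 \<le> d" "i < N" "j < N" "i \<noteq> j"
  shows "0 \<le> L_mat d p V $$ (i, j)"
  using assms by (auto simp: L_mat_def Let_def)

text \<open>Each factor moves positivity one site back along the cycle or, the diagonal being
  positive, keeps it in place. A positive entry \<open>i\<close> sites ahead of \<open>j\<close>
  thus arrives in \<open>k \<ge> i\<close> steps.\<close>

lemma L_mat_pow_pos:
  assumes V: "V \<in> carrier_vec N" "\<And>j. j < N \<Longrightarrow> 2 * d < V $ j" and "0 < d"
    and "x \<in> carrier_vec N" "\<And>j. j < N \<Longrightarrow> 0 \<le> x $ j"
    and "j < N" "i \<le> k" "0 < x $ ((j + i) mod N)"
  shows "0 < (L_mat d p V ^\<^sub>m k *\<^sub>v x) $ j"
  using assms(4-)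
proof (induction k arbitrary: x i)
  case 0
  then show ?case using V by (simp add: L_mat_def Let_def)
next
  case (Suc k)
  let ?A = "L_mat d p V"
  have A: "?A \<in> carrier_mat N N" and Ak: "?A ^\<^sub>m k \<in> carrier_mat N N"
    using L_mat_carrier[OF V(1)] by simp_all
  have Ax: "(?A *\<^sub>v x) $ l = d * exp (- p) * x $ (cyc_succ N l) + d * exp p * x $ (cyc_pred N l)
      + (V $ l - 2 * d) * x $ l" if "l < N" for l
    using L_mat_mult_vec[of x V l d p] that V(1) Suc.prems(1) by (simp add: algebra_simps)
  have terms: "0 \<le> d * exp (- p) * x $ (cyc_succ N l)" "0 \<le> d * exp p * x $ (cyc_pred N l)"
    "0 \<le> (V $ l - 2 * d) * x $ l" if "l < N" for l
    using that V(2)[OF that] \<open>0 < d\<close> by (auto intro!: mult_nonneg_nonneg Suc.prems(2))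
  have Ax_carrier: "?A *\<^sub>v x \<in> carrier_vec N"
    using mult_mat_vec_carrier[OF A Suc.prems(1)] .
  have Ax_nonneg: "0 \<le> (?A *\<^sub>v x) $ l" if "l < N" for l
    using terms[OF that] unfolding Ax[OF that] by linarith
  have "\<exists>i'\<le>k. 0 < (?A *\<^sub>v x) $ ((j + i') mod N)"
  proof (cases i)
    case 0
    then have "0 < (V $ j - 2 * d) * x $ j" using Suc.prems V(2)[of j] by simp
    then have "0 < (?A *\<^sub>v x) $ j"
      using terms[OF \<open>j < N\<close>] unfolding Ax[OF \<open>j < N\<close>] by linarith
    then show ?thesis using \<open>j < N\<close> by (intro exI[of _ 0]) auto
  next
    case (Suc i')
    define l where "l = (j + i') mod N"
    have l: "l < N" using \<open>j < N\<close> by (simp add: l_def)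
    have "cyc_succ N l = (j + i) mod N" by (simp add: l_def Suc mod_Suc_eq)
    then have "0 < d * exp (- p) * x $ (cyc_succ N l)" using Suc.prems(5) \<open>0 < d\<close> by simp
    then have "0 < (?A *\<^sub>v x) $ l"
      using terms[OF l] unfolding Ax[OF l] by linarith
    then show ?thesis using Suc Suc.prems(4) by (intro exI[of _ i']) (auto simp: l_def)
  qed
  then have "0 < (?A ^\<^sub>m k *\<^sub>v (?A *\<^sub>v x)) $ j"
    using Suc.IH[OF Ax_carrier Ax_nonneg \<open>j < N\<close>] by blast
  then show ?case
    using assoc_mult_mat_vec[OF Ak A Suc.prems(1)] by simp
qed

text \<open>Adding a large constant to the potential shifts the eigenvalues and makes the matrix
  nonnegative and primitive, so \<open>perron_eigenvector\<close> applies;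
  \<open>spectral_bound_eqI\<close> identifies the eigenvalue after shifting back.\<close>

lemma L_mat_positive_eigenvector:
  assumes V: "V \<in> carrier_vec N" and "0 < N" "0 < d"
  obtains u where "u \<in> carrier_vec N" "\<And>j. j < N \<Longrightarrow> 0 < u $ j"
    "\<And>j. j < N \<Longrightarrow> d * (exp (- p) * u $ (cyc_succ N j) + exp p * u $ (cyc_pred N j) - 2 * u $ j)
      + V $ j * u $ j = principal_eigenvalue d p V * u $ j"
proof -
  define c where "c = 2 * d + 1 + (\<Sum>j<N. \<bar>V $ j\<bar>)"
  define W where "W = vec N (\<lambda>j. V $ j + c)"
  have W: "W \<in> carrier_vec N" by (simp add: W_def)
  have W_gt: "2 * d < W $ j" if "j < N" for j
  proof -
    have "\<bar>V $ j\<bar> \<le> (\<Sum>j<N. \<bar>V $ j\<bar>)" using that by (intro member_le_sum) auto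
    then show ?thesis using that by (simp add: W_def c_def)
  qed
  let ?A = "L_mat d p W"
  have A: "?A \<in> carrier_mat N N" by (rule L_mat_carrier[OF W])
  have nonneg: "0 \<le> ?A $$ (i, j)" if "i < N" "j < N" for i j
    using W_gt[OF that(1)] W that \<open>0 < d\<close> by (auto simp: L_mat_def Let_def)
  have prim: "0 < (?A ^\<^sub>m N *\<^sub>v x) $ j"
    if x: "x \<in> carrier_vec N" "x \<noteq> 0\<^sub>v N" "\<And>j. j < N \<Longrightarrow> 0 \<le> x $ j" and j: "j < N" for x j
  proof -
    obtain l where l: "l < N" "x $ l \<noteq> 0"
      using x(1,2) by (metis eq_vecI carrier_vecD index_zero_vec)
    \<comment> \<open>The forward distance from \<open>j\<close> to \<open>l\<close> on the cycle;
      it is at most \<open>N\<close>, so the power \<open>N\<close> suffices.\<close>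
    define i where "i = (if j \<le> l then l - j else l + N - j)"
    have "i \<le> N" "(j + i) mod N = l" using l j by (auto simp: i_def)
    then show ?thesis
      using x l j W_gt \<open>0 < d\<close> by (intro L_mat_pow_pos[OF W]) (auto simp: less_le)
  qed
  obtain r u where u: "u \<in> carrier_vec N" "\<And>i. i < N \<Longrightarrow> 0 < u $ i" and ev: "?A *\<^sub>v u = r \<cdot>\<^sub>v u"
    using perron_eigenvector[OF A \<open>0 < N\<close> nonneg prim] by blast
  have dim: "dim_vec W = N" "dim_vec V = N" "dim_vec u = N" using W V u by auto
  have ev_V: "L_mat d p V *\<^sub>v u = (r - c) \<cdot>\<^sub>v u"
  proof (rule eq_vecI)
    fix j assume "j < dim_vec ((r - c) \<cdot>\<^sub>v u)"
    then have j: "j < N" using u by simp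
    have "(?A *\<^sub>v u) $ j = r * u $ j" using j u by (simp add: ev)
    then show "(L_mat d p V *\<^sub>v u) $ j = ((r - c) \<cdot>\<^sub>v u) $ j"
      using L_mat_mult_vec[of u W j d p] L_mat_mult_vec[of u V j d p] j u
      by (simp add: dim W_def algebra_simps del: index_mult_mat_vec)
  qed (use L_mat_carrier[OF V] dim in auto)
  have "principal_eigenvalue d p V = r - c"
    unfolding principal_eigenvalue_def
    using L_mat_carrier[OF V] \<open>0 < N\<close> u ev_V \<open>0 < d\<close>
    by (intro spectral_bound_eqI[of _ N u]) (auto intro!: L_mat_off_diag_nonneg[OF V])
  then show ?thesis
    using that[OF u] ev_V L_mat_mult_vec[of u V _ d p] u by (simp add: dim)
qed

subsection \<open>Duality for the phase energy\<close>

text \<open>For \<open>w > 0\<close> this is the minimum over \<open>t\<close> of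
  \<open>w * cosh t - l * t\<close>, evaluated at the minimiser
  \<open>t = arsinh (l / w)\<close>.\<close>

definition phase_dual :: "real \<Rightarrow> real \<Rightarrow> real" where
  "phase_dual l w = sqrt (w\<^sup>2 + l\<^sup>2) - l * arsinh (l / w)"

text \<open>The second hypothesis is the stationarity condition in \<open>t\<close>; under it the
  square root in \<open>phase_dual\<close> is \<open>w * cosh t\<close>.\<close>

lemma phase_dual_eq:
  assumes "0 < w" "w * sinh t = l"
  shows "phase_dual l w = w * cosh t - l * t"
proof -
  have "l / w = sinh t" using assms by auto
  then have "arsinh (l / w) = t" by (simp add: arsinh_sinh_real)
  moreover have "w\<^sup>2 + l\<^sup>2 = (w * cosh t)\<^sup>2"
    using assms(2) cosh_square_eq[of t] by (auto simp: power_mult_distrib algebra_simps)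
  then have "sqrt (w\<^sup>2 + l\<^sup>2) = w * cosh t" using assms(1) by simp
  ultimately show ?thesis by (simp add: phase_dual_def)
qed

text \<open>The tangent to \<open>w * cosh\<close> at the stationary point has slope
  \<open>l\<close>.\<close>

lemma phase_dual_le:
  assumes "0 < w"
  shows "l * t + phase_dual l w \<le> w * cosh t"
proof -
  define s where "s = arsinh (l / w)"
  have s: "w * sinh s = l" using assms by (simp add: s_def)
  have "w * (cosh s + sinh s * (t - s)) \<le> w * cosh t"
    using assms by (intro mult_left_mono cosh_above_tangent) auto
  then show ?thesis
    unfolding phase_dual_eq[OF assms s] using s by (simp add: algebra_simps)
qed

text \<open>The derivative is \<open>cosh\<close> of the minimiser, as the envelope principle
  predicts. Multiplied by \<open>w\<close> it becomes \<open>sqrt (w\<^sup>2 + l\<^sup>2)\<close>,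
  which increases with \<open>w\<close>; this drives supermodularity.\<close>

lemma phase_dual_has_derivative:
  assumes "0 < w"
  shows "(phase_dual l has_real_derivative sqrt (w\<^sup>2 + l\<^sup>2) / w) (at w)"
proof -
  define q where "q = sqrt (w\<^sup>2 + l\<^sup>2)"
  have pos: "0 < w\<^sup>2 + l\<^sup>2" using assms by (simp add: add_pos_nonneg)
  have q: "0 < q" "q\<^sup>2 = w\<^sup>2 + l\<^sup>2" using pos by (auto simp: q_def)
  have "(l / w)\<^sup>2 + 1 = (q / w)\<^sup>2"
    using assms q by (simp add: power_divide field_simps)
  then have "sqrt ((l / w)\<^sup>2 + 1) = q / w" using assms q by simp
  moreover have "((\<lambda>w. sqrt (w\<^sup>2 + l\<^sup>2) - l * arsinh (l / w)) has_real_derivative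
      w / q - l * (1 / sqrt ((l / w)\<^sup>2 + 1) * (- l / w\<^sup>2))) (at w)"
    using assms pos by (auto intro!: derivative_eq_intros DERIV_chain2[OF arsinh_real_has_field_derivative]
      simp: q_def field_simps power2_eq_square)
  ultimately have D: "(phase_dual l has_real_derivative w / q + l * (w / q * (l / w\<^sup>2))) (at w)"
    by (simp add: phase_dual_def[abs_def])
  have "w / q + l * (w / q * (l / w\<^sup>2)) = (w\<^sup>2 + l\<^sup>2) / (q * w)"
    using assms q(1) by (simp add: field_simps power2_eq_square)
  then have "w / q + l * (w / q * (l / w\<^sup>2)) = q / w"
    unfolding q(2)[symmetric] using q(1) by (simp add: power2_eq_square)
  with D show ?thesis by (simp add: q_def)
qed

text \<open>Equivalently, \<open>phase_dual l (exp s)\<close> is convex in \<open>s\<close>.\<close>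

lemma phase_dual_mult_supermodular:
  assumes "0 < x" "x \<le> x'" "0 < y" "y \<le> y'"
  shows "phase_dual l (x * y') + phase_dual l (x' * y) \<le> phase_dual l (x * y) + phase_dual l (x' * y')"
proof -
  \<comment> \<open>Supermodularity in the form of increasing differences, proved by differentiating
    in the second argument.\<close>
  have "phase_dual l (x' * y) - phase_dual l (x * y) \<le> phase_dual l (x' * y') - phase_dual l (x * y')"
  proof (rule DERIV_nonneg_imp_nondecreasing[OF \<open>y \<le> y'\<close>])
    fix z assume "y \<le> z" "z \<le> y'"
    then have pos: "0 < z" "0 < x * z" "0 < x' * z" using assms by auto
    have d: "((\<lambda>z. phase_dual l (k * z)) has_real_derivative
        sqrt ((k * z)\<^sup>2 + l\<^sup>2) / (k * z) * k) (at z)" if "0 < k * z" for k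
      by (rule DERIV_chain2[where g = "\<lambda>z. k * z", OF phase_dual_has_derivative[OF that]])
        (auto intro!: derivative_eq_intros)
    have "((\<lambda>z. phase_dual l (x' * z) - phase_dual l (x * z)) has_real_derivative
        sqrt ((x' * z)\<^sup>2 + l\<^sup>2) / (x' * z) * x' - sqrt ((x * z)\<^sup>2 + l\<^sup>2) / (x * z) * x) (at z)"
      by (intro DERIV_diff d pos)
    moreover have "sqrt ((x' * z)\<^sup>2 + l\<^sup>2) / (x' * z) * x' - sqrt ((x * z)\<^sup>2 + l\<^sup>2) / (x * z) * x
        = (sqrt ((x' * z)\<^sup>2 + l\<^sup>2) - sqrt ((x * z)\<^sup>2 + l\<^sup>2)) / z"
      using assms pos by (simp add: field_simps)
    moreover have "0 \<le> (sqrt ((x' * z)\<^sup>2 + l\<^sup>2) - sqrt ((x * z)\<^sup>2 + l\<^sup>2)) / z"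
      using assms pos by (auto intro!: divide_nonneg_pos power_mono)
    ultimately show "\<exists>D. ((\<lambda>z. phase_dual l (x' * z) - phase_dual l (x * z)) has_real_derivative D) (at z)
        \<and> 0 \<le> D" by auto
  qed
  then show ?thesis by simp
qed

lemma T_fun_le:
  assumes "a \<in> pos_unit_vecs N" "0 < N" "\<theta> \<in> phase_constraint N \<sigma>"
  shows "T_fun \<sigma> a \<le> (\<Sum>j<N. a $ j * a $ (cyc_succ N j) * cosh (\<theta> $ j))"
proof -
  have "dim_vec a = N" using assms(1) by (auto simp: pos_unit_vecs_def)
  then have "phase_energy a \<theta> = (\<Sum>j<N. a $ j * a $ (cyc_succ N j) * cosh (\<theta> $ j))"
    by (simp add: phase_energy_def Let_def)
  moreover have "T_fun \<sigma> a \<le> phase_energy a \<theta>"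
    using phase_energy_min_attained[OF assms(1,2), of \<sigma>] assms(3) by auto
  ultimately show ?thesis by simp
qed

text \<open>Weak duality, for every multiplier \<open>l\<close>: \<open>phase_dual_le\<close> is
  summed over the edges at minimising phases, whose total is \<open>\<sigma>\<close>.\<close>

lemma T_fun_ge_dual:
  assumes a: "a \<in> pos_unit_vecs N" and "0 < N"
  shows "l * \<sigma> + (\<Sum>j<N. phase_dual l (a $ j * a $ (cyc_succ N j))) \<le> T_fun \<sigma> a"
proof -
  have dim: "dim_vec a = N" using a by (auto simp: pos_unit_vecs_def)
  have w: "0 < a $ j * a $ (cyc_succ N j)" if "j < N" for j
    using a that \<open>0 < N\<close> by (auto simp: pos_unit_vecs_def)
  obtain \<theta> where \<theta>: "\<theta> \<in> phase_constraint N \<sigma>" "T_fun \<sigma> a = phase_energy a \<theta>"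
    using phase_energy_min_attained[OF assms] by auto
  have "l * \<sigma> + (\<Sum>j<N. phase_dual l (a $ j * a $ (cyc_succ N j)))
      = (\<Sum>j<N. l * \<theta> $ j + phase_dual l (a $ j * a $ (cyc_succ N j)))"
    using \<theta>(1) by (auto simp: phase_constraint_def sum.distrib sum_distrib_left)
  also have "\<dots> \<le> (\<Sum>j<N. a $ j * a $ (cyc_succ N j) * cosh (\<theta> $ j))"
    using w by (intro sum_mono phase_dual_le) auto
  finally show ?thesis by (simp add: \<theta>(2) phase_energy_def Let_def dim)
qed

text \<open>Strong duality: the intermediate value theorem gives a multiplier whose stationary
  phases \<open>arsinh (l / w j)\<close> add up to \<open>\<sigma>\<close>, and there
  \<open>phase_dual_eq\<close> is exact on every edge.\<close>

lemma T_fun_le_dual: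
  assumes a: "a \<in> pos_unit_vecs N" and "0 < N"
  obtains l where "T_fun \<sigma> a \<le> l * \<sigma> + (\<Sum>j<N. phase_dual l (a $ j * a $ (cyc_succ N j)))"
proof -
  define w where "w j = a $ j * a $ (cyc_succ N j)" for j
  have w: "0 < w j" if "j < N" for j
    using a that \<open>0 < N\<close> by (auto simp: pos_unit_vecs_def w_def)
  define h where "h l = (\<Sum>j<N. arsinh (l / w j))" for l
  have "continuous_on UNIV h" unfolding h_def using w
    by (intro continuous_intros) (auto simp: less_imp_neq[symmetric])
  then have cont: "isCont h l" for l by (auto simp: continuous_on_eq_continuous_at)
  \<comment> \<open>At \<open>l0\<close> edge \<open>0\<close> alone contributes
    \<open>\<bar>\<sigma>\<bar>\<close> to \<open>h\<close> and the other terms are nonnegative; as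
    \<open>h\<close> is odd, \<open>- l0\<close> and \<open>l0\<close> bracket the solution.\<close>
  define l0 where "l0 = w 0 * sinh \<bar>\<sigma>\<bar>"
  have l0: "0 \<le> l0" using w[OF \<open>0 < N\<close>] by (simp add: l0_def)
  have "arsinh (l0 / w 0) \<le> h l0"
    unfolding h_def using \<open>0 < N\<close> l0 w
    by (intro member_le_sum) (auto simp: not_less[symmetric] divide_less_0_iff dest: w)
  moreover have "arsinh (l0 / w 0) = \<bar>\<sigma>\<bar>"
    using w[OF \<open>0 < N\<close>] by (simp add: l0_def arsinh_sinh_real del: sinh_real_abs)
  moreover have "h (- l0) = - h l0" by (simp add: h_def sum_negf)
  ultimately have "h (- l0) \<le> \<sigma>" "\<sigma> \<le> h l0" by auto
  then obtain l where l: "h l = \<sigma>" using IVT[of h "- l0" \<sigma> l0] l0 cont by auto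
  define \<theta> where "\<theta> = vec N (\<lambda>j. arsinh (l / w j))"
  have "\<theta> \<in> phase_constraint N \<sigma>" using l by (simp add: \<theta>_def phase_constraint_def h_def)
  then have "T_fun \<sigma> a \<le> (\<Sum>j<N. w j * cosh (\<theta> $ j))"
    unfolding w_def by (rule T_fun_le[OF assms])
  also have "\<dots> = (\<Sum>j<N. l * arsinh (l / w j) + phase_dual l (w j))"
  proof (rule sum.cong)
    fix j assume "j \<in> {..<N}"
    then have j: "j < N" by simp
    have "w j * sinh (arsinh (l / w j)) = l" using w[OF j] by simp
    from phase_dual_eq[OF w[OF j] this]
    show "w j * cosh (\<theta> $ j) = l * arsinh (l / w j) + phase_dual l (w j)"
      using j by (simp add: \<theta>_def)
  qed simp
  also have "\<dots> = l * \<sigma> + (\<Sum>j<N. phase_dual l (w j))"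
    by (simp add: sum.distrib sum_distrib_left[symmetric] l[symmetric] h_def)
  finally show ?thesis using that by (simp add: w_def)
qed

text \<open>The multiplier that is optimal for \<open>a\<close> is kept: strong duality at
  \<open>a\<close>, the cycle inequality for this fixed \<open>l\<close>, then weak duality at
  \<open>bell a\<close>.\<close>

lemma T_fun_le_bell:
  assumes a: "a \<in> pos_unit_vecs N" and "2 \<le> N"
  shows "T_fun \<sigma> a \<le> T_fun \<sigma> (bell a)"
proof -
  have "0 < N" using \<open>2 \<le> N\<close> by simp
  have ca: "a \<in> carrier_vec N" and pos: "\<And>j. j < N \<Longrightarrow> 0 < a $ j"
    using a by (auto simp: pos_unit_vecs_def)
  obtain l where l: "T_fun \<sigma> a \<le> l * \<sigma> + (\<Sum>j<N. phase_dual l (a $ j * a $ (cyc_succ N j)))"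
    using T_fun_le_dual[OF a \<open>0 < N\<close>] .
  define F where "F x y = phase_dual l (x * y)" for x y
  have cyc: "(\<Sum>j<N. phase_dual l (x $ j * x $ (cyc_succ N j))) = cycle_sum F (list_of_vec x)"
    if "x \<in> carrier_vec N" for x
  proof -
    have "length (list_of_vec x) = N" using that by simp
    moreover from this have "list_of_vec x \<noteq> []" 
      using \<open>0 < N\<close> by (metis list.size(3) less_irrefl)
    ultimately show ?thesis using that by (simp add: cycle_sum_conv_sum F_def)
  qed
  have "cycle_sum F (list_of_vec a) \<le> cycle_sum F (list_of_vec (bell a))"
    unfolding list_of_vec_bell[OF ca \<open>0 < N\<close>]
  proof (rule cycle_sum_le_bell_order[where S = "{0<..}", OF _ _ \<open>2 \<le> N\<close>])
    show "F x y = F y x" for x y by (simp add: F_def mult.commute)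
    show "F x y' + F x' y \<le> F x y + F x' y'"
      if "x \<in> {0<..}" "y \<in> {0<..}" "x \<le> x'" "y \<le> y'" for x x' y y'
      unfolding F_def using that by (intro phase_dual_mult_supermodular) auto
    show "decreasing_entries a ! (i - 1) \<in> {0<..}" if "1 \<le> i" "i \<le> N" for i
      using decreasing_entries_mem[OF ca that] pos by auto
    show "mset (list_of_vec a) = mset (map (\<lambda>k. decreasing_entries a ! (k - 1)) [1..<N + 1])"
      using mset_entries[OF ca] by (simp del: upt_Suc)
  qed (rule decreasing_entries_antitone[OF ca])
  then show ?thesis
    using l T_fun_ge_dual[OF bell_pos_unit_vecs[OF a \<open>0 < N\<close>] \<open>0 < N\<close>, of l \<sigma>]
    unfolding cyc[OF ca] cyc[OF bell_carrier[OF ca]] by linarith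
qed

subsection \<open>Variational formula for the principal eigenvalue\<close>

text \<open>The right Perron vector \<open>u\<close> gives trial phases, the differences of
  \<open>ln (u / a)\<close> minus \<open>p\<close>, with total \<open>- N p\<close> by telescoping.
  Their energy turns the left-hand side into the eigenvalue equation weighted by
  \<open>a\<^sup>2 / u\<close>.\<close>

lemma principal_eigenvalue_ge:
  assumes V: "V \<in> carrier_vec N" and a: "a \<in> pos_unit_vecs N" and "0 < N" "0 < d"
  shows "2 * d * T_fun (- (real N * p)) a + (\<Sum>j<N. (V $ j - 2 * d) * (a $ j)\<^sup>2)
    \<le> principal_eigenvalue d p V"
proof -
  let ?\<Lambda> = "principal_eigenvalue d p V"
  obtain u where u: "\<And>j. j < N \<Longrightarrow> 0 < u $ j"
    and ev: "\<And>j. j < N \<Longrightarrow> d * (exp (- p) * u $ (cyc_succ N j) + exp p * u $ (cyc_pred N j) - 2 * u $ j)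
      + V $ j * u $ j = ?\<Lambda> * u $ j"
    using L_mat_positive_eigenvector[OF V \<open>0 < N\<close> \<open>0 < d\<close>, of p] by blast
  have pos: "\<And>j. j < N \<Longrightarrow> 0 < a $ j" and one: "(\<Sum>j<N. (a $ j)\<^sup>2) = 1"
    using a by (auto simp: pos_unit_vecs_def)
  have succ: "cyc_succ N j < N" for j using \<open>0 < N\<close> by simp
  define s where "s j = ln (u $ j / a $ j)" for j
  have es: "exp (s j) = u $ j / a $ j" if "j < N" for j
    using u pos that by (simp add: s_def)
  define \<theta> where "\<theta> = vec N (\<lambda>j. s (cyc_succ N j) - s j - p)"
  have "(\<Sum>j<N. \<theta> $ j) = - (real N * p)"
    using sum_cyc_succ[where f = s and N = N] by (simp add: \<theta>_def sum_subtractf)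
  then have \<theta>: "\<theta> \<in> phase_constraint N (- (real N * p))"
    by (simp add: phase_constraint_def) (simp add: \<theta>_def)
  \<comment> \<open>\<open>F j\<close> and \<open>B j\<close> are the two hopping terms at site
    \<open>j\<close>, without the factor \<open>d\<close>, weighted by
    \<open>(a $ j)\<^sup>2 / u $ j\<close>.\<close>
  define F where "F j = exp (- p) * (a $ j)\<^sup>2 * u $ (cyc_succ N j) / u $ j" for j
  define B where "B j = exp p * (a $ j)\<^sup>2 * u $ (cyc_pred N j) / u $ j" for j
  have "2 * d * T_fun (- (real N * p)) a
      \<le> 2 * d * (\<Sum>j<N. a $ j * a $ (cyc_succ N j) * cosh (\<theta> $ j))"
    using \<open>0 < d\<close> by (intro mult_left_mono T_fun_le[OF a \<open>0 < N\<close> \<theta>]) auto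
  also have "\<dots> = (\<Sum>j<N. d * (F j + B (cyc_succ N j)))"
    unfolding sum_distrib_left
  proof (rule sum.cong)
    fix j assume "j \<in> {..<N}"
    then have j: "j < N" by simp
    let ?k = "cyc_succ N j"
    have "exp (\<theta> $ j) = exp (s ?k) / exp (s j) * exp (- p)"
      using j by (simp add: \<theta>_def flip: exp_add exp_diff)
    then have e1: "exp (\<theta> $ j) = u $ ?k / a $ ?k / (u $ j / a $ j) * exp (- p)"
      by (simp only: es[OF j] es[OF succ])
    have "exp (- \<theta> $ j) = exp (s j) / exp (s ?k) * exp p"
      using j by (simp add: \<theta>_def algebra_simps flip: exp_add exp_diff)
    then have e2: "exp (- \<theta> $ j) = u $ j / a $ j / (u $ ?k / a $ ?k) * exp p"
      by (simp only: es[OF j] es[OF succ])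
    have "a $ j * a $ ?k * exp (\<theta> $ j) = F j" "a $ j * a $ ?k * exp (- \<theta> $ j) = B ?k"
      unfolding e1 e2 F_def B_def cyc_pred_succ[OF j]
      using u[OF j] pos[OF j] u[OF succ[of j]] pos[OF succ[of j]]
      by (simp_all add: field_simps power2_eq_square)
    then have "2 * (a $ j * a $ ?k * cosh (\<theta> $ j)) = F j + B ?k"
      by (simp add: cosh_def distrib_left)
    then show "2 * d * (a $ j * a $ ?k * cosh (\<theta> $ j)) = d * (F j + B ?k)"
      by (metis mult.assoc mult.commute)
  qed simp
  also have "\<dots> = (\<Sum>j<N. d * (F j + B j))"
    using sum_cyc_succ[where f = B and N = N]
    by (simp add: sum_distrib_left[symmetric] sum.distrib)
  finally have "2 * d * T_fun (- (real N * p)) a + (\<Sum>j<N. (V $ j - 2 * d) * (a $ j)\<^sup>2)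
      \<le> (\<Sum>j<N. d * (F j + B j) + (V $ j - 2 * d) * (a $ j)\<^sup>2)"
    by (simp add: sum.distrib)
  also have "\<dots> = (\<Sum>j<N. ?\<Lambda> * (a $ j)\<^sup>2)"
  proof (rule sum.cong)
    fix j assume "j \<in> {..<N}"
    then have j: "j < N" by simp
    have "d * (F j + B j) + (V $ j - 2 * d) * (a $ j)\<^sup>2 = (a $ j)\<^sup>2 / u $ j *
        (d * (exp (- p) * u $ (cyc_succ N j) + exp p * u $ (cyc_pred N j) - 2 * u $ j) + V $ j * u $ j)"
      using u[OF j] by (simp add: F_def B_def field_simps)
    also have "\<dots> = ?\<Lambda> * (a $ j)\<^sup>2" unfolding ev[OF j] using u[OF j] by simp
    finally show "d * (F j + B j) + (V $ j - 2 * d) * (a $ j)\<^sup>2 = ?\<Lambda> * (a $ j)\<^sup>2" .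
  qed simp
  also have "\<dots> = ?\<Lambda>" by (simp add: sum_distrib_left[symmetric] one)
  finally show ?thesis .
qed

text \<open>The transpose of \<open>L_mat d p V\<close> is \<open>L_mat d (- p) V\<close>; \<open>u\<close> and \<open>v\<close> are the right and left
  Perron vectors, and \<open>a = sqrt (u v)\<close> up to normalisation. The two eigenvalue equations say that
  the flux along each edge is the same, which is the optimality condition for the phases \<open>\<theta>\<close>.\<close>

lemma principal_eigenvalue_le:
  assumes V: "V \<in> carrier_vec N" and "0 < N" "0 < d"
  obtains a where "a \<in> pos_unit_vecs N" "principal_eigenvalue d p V \<le>
    2 * d * T_fun (- (real N * p)) a + (\<Sum>j<N. (V $ j - 2 * d) * (a $ j)\<^sup>2)"
proof -
  let ?\<Lambda> = "principal_eigenvalue d p V" and ?\<Lambda>' = "principal_eigenvalue d (- p) V"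
  obtain u where u: "\<And>j. j < N \<Longrightarrow> 0 < u $ j"
    and evu: "\<And>j. j < N \<Longrightarrow> d * (exp (- p) * u $ (cyc_succ N j) + exp p * u $ (cyc_pred N j) - 2 * u $ j)
      + V $ j * u $ j = ?\<Lambda> * u $ j"
    using L_mat_positive_eigenvector[OF V \<open>0 < N\<close> \<open>0 < d\<close>, of p] by blast
  obtain v where v: "\<And>j. j < N \<Longrightarrow> 0 < v $ j"
    and evv: "\<And>j. j < N \<Longrightarrow> d * (exp p * v $ (cyc_succ N j) + exp (- p) * v $ (cyc_pred N j) - 2 * v $ j)
      + V $ j * v $ j = ?\<Lambda>' * v $ j"
    using L_mat_positive_eigenvector[OF V \<open>0 < N\<close> \<open>0 < d\<close>, of "- p", unfolded minus_minus] by blast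
  have succ: "cyc_succ N j < N" for j using \<open>0 < N\<close> by simp
  define c where "c = (\<Sum>j<N. u $ j * v $ j)"
  have c: "0 < c" unfolding c_def using u v \<open>0 < N\<close> by (intro sum_pos) auto
  \<comment> \<open>\<open>P j\<close> and \<open>Q j\<close> belong to the edge leaving
    \<open>j\<close>; \<open>P'\<close> and \<open>Q'\<close> are the same quantities for the edge
    entering \<open>j\<close>.\<close>
  define P where "P j = exp (- p) * u $ (cyc_succ N j) * v $ j" for j
  define Q where "Q j = exp p * u $ j * v $ (cyc_succ N j)" for j
  define P' where "P' j = exp (- p) * u $ j * v $ (cyc_pred N j)" for j
  define Q' where "Q' j = exp p * u $ (cyc_pred N j) * v $ j" for j
  have P': "P' (cyc_succ N j) = P j" "Q' (cyc_succ N j) = Q j" if "j < N" for j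
    unfolding P_def P'_def Q_def Q'_def cyc_pred_succ[OF that] by simp_all
  have sumPQ: "(\<Sum>j<N. P' j) = (\<Sum>j<N. P j)" "(\<Sum>j<N. Q' j) = (\<Sum>j<N. Q j)"
    using sum_cyc_succ[where f = P' and N = N] sum_cyc_succ[where f = Q' and N = N] P'
    by simp_all
  define D where "D = (\<Sum>j<N. (V $ j - 2 * d) * (u $ j * v $ j))"
  have eu: "d * (P j + Q' j) + (V $ j - 2 * d) * (u $ j * v $ j) = ?\<Lambda> * (u $ j * v $ j)"
    if "j < N" for j
    using arg_cong[OF evu[OF that], of "\<lambda>t. v $ j * t"] by (simp add: P_def Q'_def algebra_simps)
  have ev: "d * (Q j + P' j) + (V $ j - 2 * d) * (u $ j * v $ j) = ?\<Lambda>' * (u $ j * v $ j)"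
    if "j < N" for j
    using arg_cong[OF evv[OF that], of "\<lambda>t. u $ j * t"] by (simp add: Q_def P'_def algebra_simps)
  have "(\<Sum>j<N. d * (P j + Q' j) + (V $ j - 2 * d) * (u $ j * v $ j)) = ?\<Lambda> * c"
    unfolding c_def sum_distrib_left using eu by (intro sum.cong) auto
  then have \<Lambda>: "d * ((\<Sum>j<N. P j) + (\<Sum>j<N. Q j)) + D = ?\<Lambda> * c"
    by (simp add: sum.distrib sum_distrib_left[symmetric] sumPQ D_def)
  have "(\<Sum>j<N. d * (Q j + P' j) + (V $ j - 2 * d) * (u $ j * v $ j)) = ?\<Lambda>' * c"
    unfolding c_def sum_distrib_left using ev by (intro sum.cong) auto
  then have "d * ((\<Sum>j<N. P j) + (\<Sum>j<N. Q j)) + D = ?\<Lambda>' * c"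
    by (simp add: sum.distrib sum_distrib_left[symmetric] sumPQ D_def add.commute)
  \<comment> \<open>Each equation, paired with the other Perron vector and summed, gives the same
    total.\<close>
  then have \<Lambda>': "?\<Lambda>' = ?\<Lambda>" using \<Lambda> c by simp
  \<comment> \<open>Subtracting the two equations at \<open>j\<close> cancels potential and
    eigenvalue and leaves flux conservation.\<close>
  have step: "P j - Q j = P' j - Q' j" if "j < N" for j
  proof -
    have "d * (P j + Q' j) = d * (Q j + P' j)"
      using eu[OF that] ev[OF that] unfolding \<Lambda>' by linarith
    then show ?thesis using \<open>0 < d\<close> by simp
  qed
  have flux: "P j - Q j = P 0 - Q 0" if "j < N" for j
    using that
  proof (induction j)
    case (Suc j)
    then show ?case using step[of "Suc j"] P'[of j] by simp
  qed simp
  \<comment> \<open>The geometric mean is written with \<open>exp\<close> and \<open>ln\<close> so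
    that it combines with the phases by \<open>exp_add\<close>; \<open>sqrt c\<close> normalises
    it.\<close>
  define a where "a = vec N (\<lambda>j. exp ((ln (u $ j) + ln (v $ j)) / 2) / sqrt c)"
  have a2: "(a $ j)\<^sup>2 = u $ j * v $ j / c" if "j < N" for j
  proof -
    have "(exp (t / 2))\<^sup>2 = exp t" for t :: real using exp_double[of "t / 2"] by simp
    then have "(a $ j)\<^sup>2 = exp (ln (u $ j) + ln (v $ j)) / c"
      using that c by (simp add: a_def power_divide)
    then show ?thesis using u[OF that] v[OF that] by (simp add: exp_add)
  qed
  have a: "a \<in> pos_unit_vecs N"
    using c a2 by (auto simp: pos_unit_vecs_def sum_divide_distrib[symmetric] c_def[symmetric])
      (auto simp: a_def)
  \<comment> \<open>This is \<open>ln (u / a)\<close> up to an additive constant, which cancels in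
    \<open>\<theta>\<close>.\<close>
  define s where "s j = (ln (u $ j) - ln (v $ j)) / 2" for j
  define \<theta> where "\<theta> j = s (cyc_succ N j) - s j - p" for j
  define w where "w j = a $ j * a $ (cyc_succ N j)" for j
  \<comment> \<open>The multiplier is the constant flux, scaled so that
    \<open>w j * sinh (\<theta> j) = l\<close>.\<close>
  define l where "l = (P 0 - Q 0) / (2 * c)"
  have w: "0 < w j" if "j < N" for j
    using a that succ by (auto simp: w_def pos_unit_vecs_def)
  have wP: "w j * exp (\<theta> j) = P j / c" and wQ: "w j * exp (- \<theta> j) = Q j / c" if "j < N" for j
  proof -
    let ?k = "cyc_succ N j"
    have "w j = exp ((ln (u $ j) + ln (v $ j)) / 2 + (ln (u $ ?k) + ln (v $ ?k)) / 2) / c"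
      using that succ[of j] c by (simp add: w_def a_def exp_add)
    moreover have "(ln (u $ j) + ln (v $ j)) / 2 + (ln (u $ ?k) + ln (v $ ?k)) / 2 + \<theta> j
        = - p + ln (u $ ?k) + ln (v $ j)"
      "(ln (u $ j) + ln (v $ j)) / 2 + (ln (u $ ?k) + ln (v $ ?k)) / 2 + - \<theta> j
        = p + ln (u $ j) + ln (v $ ?k)"
      by (simp_all add: \<theta>_def s_def field_simps)
    ultimately have "w j * exp (\<theta> j) = exp (- p + ln (u $ ?k) + ln (v $ j)) / c"
      "w j * exp (- \<theta> j) = exp (p + ln (u $ j) + ln (v $ ?k)) / c"
      by (metis exp_add times_divide_eq_left)+
    then show "w j * exp (\<theta> j) = P j / c" "w j * exp (- \<theta> j) = Q j / c"
      using u[OF that] v[OF that] u[OF succ[of j]] v[OF succ[of j]]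
      by (simp_all add: exp_add exp_diff exp_minus P_def Q_def divide_inverse ac_simps)
  qed
  have "w j * sinh (\<theta> j) = l" if "j < N" for j
    using wP[OF that] wQ[OF that] flux[OF that] c
    by (simp add: sinh_def l_def algebra_simps diff_divide_distrib[symmetric])
  then have dual: "phase_dual l (w j) = w j * cosh (\<theta> j) - l * \<theta> j" if "j < N" for j
    using that w by (intro phase_dual_eq) auto
  have "(\<Sum>j<N. \<theta> j) = - (real N * p)"
    using sum_cyc_succ[where f = s and N = N] by (simp add: \<theta>_def sum_subtractf)
  then have "(\<Sum>j<N. w j * cosh (\<theta> j)) = l * (- (real N * p)) + (\<Sum>j<N. phase_dual l (w j))"
    by (simp add: dual sum_subtractf sum_distrib_left[symmetric])
  also have "\<dots> \<le> T_fun (- (real N * p)) a"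
    using T_fun_ge_dual[OF a \<open>0 < N\<close>, of l "- (real N * p)"] by (simp add: w_def)
  finally have T: "2 * d * (\<Sum>j<N. w j * cosh (\<theta> j)) \<le> 2 * d * T_fun (- (real N * p)) a"
    using \<open>0 < d\<close> by simp
  have "2 * d * (\<Sum>j<N. w j * cosh (\<theta> j)) = d * ((\<Sum>j<N. P j) + (\<Sum>j<N. Q j)) / c"
  proof -
    have "2 * (w j * cosh (\<theta> j)) = P j / c + Q j / c" if "j < N" for j
      using wP[OF that] wQ[OF that] by (simp add: cosh_def algebra_simps)
    then have "2 * (\<Sum>j<N. w j * cosh (\<theta> j)) = (\<Sum>j<N. P j / c + Q j / c)"
      by (simp add: sum_distrib_left)
    then have "d * (2 * (\<Sum>j<N. w j * cosh (\<theta> j))) = d * (((\<Sum>j<N. P j) + (\<Sum>j<N. Q j)) / c)"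
      by (simp add: sum.distrib sum_divide_distrib[symmetric] add_divide_distrib)
    then show ?thesis by (simp add: mult_ac)
  qed
  moreover have "(\<Sum>j<N. (V $ j - 2 * d) * (a $ j)\<^sup>2) = D / c"
    by (simp add: a2 D_def sum_divide_distrib)
  moreover have "?\<Lambda> = d * ((\<Sum>j<N. P j) + (\<Sum>j<N. Q j)) / c + D / c"
    using \<Lambda> c by (simp add: field_simps)
  ultimately have "?\<Lambda> \<le> 2 * d * T_fun (- (real N * p)) a + (\<Sum>j<N. (V $ j - 2 * d) * (a $ j)\<^sup>2)"
    using T by linarith
  then show ?thesis using that a by blast
qed

theorem theorem1p5:
  fixes N :: nat and d \<sigma> p :: real and a V :: "real vec"
  assumes "3 \<le> N" and "0 < d"
    and "a \<in> pos_unit_vecs N" and "V \<in> carrier_vec N"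
  shows "T_fun \<sigma> (bell a) \<ge> T_fun \<sigma> a
       \<and> principal_eigenvalue d p (bell V) \<ge> principal_eigenvalue d p V"
proof
  show "T_fun \<sigma> (bell a) \<ge> T_fun \<sigma> a" using assms by (intro T_fun_le_bell) auto
next
  have "0 < N" using assms(1) by simp
  \<comment> \<open>A maximiser for \<open>V\<close>; its rearrangement serves as trial vector for
    \<open>bell V\<close>.\<close>
  obtain b where b: "b \<in> pos_unit_vecs N" "principal_eigenvalue d p V \<le>
      2 * d * T_fun (- (real N * p)) b + (\<Sum>j<N. (V $ j - 2 * d) * (b $ j)\<^sup>2)"
    using principal_eigenvalue_le[OF assms(4) \<open>0 < N\<close> assms(2)] .
  have cb: "b \<in> carrier_vec N" and pos: "\<And>j. j < N \<Longrightarrow> 0 < b $ j" and one: "(\<Sum>j<N. (b $ j)\<^sup>2) = 1"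
    using b(1) by (auto simp: pos_unit_vecs_def)
  have one': "(\<Sum>j<N. (bell b $ j)\<^sup>2) = 1"
    using bell_pos_unit_vecs[OF b(1) \<open>0 < N\<close>] by (auto simp: pos_unit_vecs_def)
  have "(\<Sum>j<N. V $ j * (b $ j)\<^sup>2) \<le> (\<Sum>j<N. bell V $ j * (bell b $ j)\<^sup>2)"
    using assms(4) cb pos \<open>0 < N\<close> by (intro sum_mult_power2_le_bell) (auto intro: less_imp_le)
  \<comment> \<open>The \<open>2 * d\<close> terms agree because \<open>b\<close> and
    \<open>bell b\<close> are both unit vectors.\<close>
  then have "(\<Sum>j<N. (V $ j - 2 * d) * (b $ j)\<^sup>2) \<le> (\<Sum>j<N. (bell V $ j - 2 * d) * (bell b $ j)\<^sup>2)"
    by (simp add: left_diff_distrib sum_subtractf sum_distrib_left[symmetric] one one')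
  moreover have "2 * d * T_fun (- (real N * p)) b \<le> 2 * d * T_fun (- (real N * p)) (bell b)"
    using assms by (intro mult_left_mono T_fun_le_bell[OF b(1)]) auto
  ultimately show "principal_eigenvalue d p (bell V) \<ge> principal_eigenvalue d p V"
    using b(2) principal_eigenvalue_ge[OF bell_carrier[OF assms(4)]
      bell_pos_unit_vecs[OF b(1) \<open>0 < N\<close>] \<open>0 < N\<close> assms(2), of p] by linarith
qed

end
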